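(* For each prime $p>3$, let $\alpha=\alpha(p)$ be the unique integer with $0<\alpha<p^2$ and $\alpha\equiv -24^{-1}\pmod{p^2}$. Then for a positive proportion of primes $p$ it holds that $$\sum_{n=0}^{\infty} b_3\bigl(2(pn+\alpha)\bigr)q^n\equiv \sum_{n=0}^{\infty} b_3(2n)\,q^{pn}\pmod 2.$$
   Context: For a positive integer $t$, $b_t(n)$ denotes the number of $t$-regular partitions of $n$, i.e. partitions of $n$ none of whose parts is divisible by $t$ (with $b_t(0)=1$); equivalently $\sum_{n\ge0}b_t(n)q^n=\prod_{j\ge1}\frac{1-q^{tj}}{1-q^j}$. A congruence between formal power series modulo $2$ means coefficientwise congruence. "A positive proportion of primes" means a set of primes having positive (lower) density within the set of all primes. *)

theory Defs
  imports
    "HOL-Number_Theory.Number_Theory"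
    "HOL-Computational_Algebra.Formal_Power_Series"
    "HOL-Analysis.Analysis"
begin

text \<open>A partition of \<open>n\<close> is the multiset of its parts, which are positive.\<close>

definition regular_partitions :: "nat \<Rightarrow> nat \<Rightarrow> nat multiset set" where
  "regular_partitions t n =
     {P. sum_mset P = n \<and> (\<forall>k\<in>#P. 0 < k \<and> \<not> t dvd k)}"

definition num_regular_partitions :: "nat \<Rightarrow> nat \<Rightarrow> nat"  (\<open>b\<^bsub>_\<^esub>\<close>) where
  "b\<^bsub>t\<^esub> n = card (regular_partitions t n)"

lemma finite_regular_partitions: "finite (regular_partitions t n)"
proof (rule finite_subset)
  have size: "size P \<le> sum_mset P" if "\<forall>k\<in>#P. 0 < k" for P :: "nat multiset"
    using that by (induction P) auto
  have part: "k \<le> sum_mset P" if "k \<in># P" for k and P :: "nat multiset"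
    using that by (auto dest!: multi_member_split)
  show "regular_partitions t n \<subseteq> mset ` {xs. set xs \<subseteq> {..n} \<and> length xs \<le> n}"
  proof
    fix P assume P: "P \<in> regular_partitions t n"
    obtain xs where xs: "P = mset xs" by (metis ex_mset)
    have n: "sum_mset P = n" and pos: "\<forall>k\<in>#P. 0 < k"
      using P by (auto simp: regular_partitions_def)
    have "length xs \<le> n"
      using size[OF pos] n by (simp add: xs)
    moreover have "set xs \<subseteq> {..n}"
      using part[of _ P] n by (auto simp: xs)
    ultimately
    show "P \<in> mset ` {xs. set xs \<subseteq> {..n} \<and> length xs \<le> n}"
      using xs by blast
  qed
  show "finite (mset ` {xs. set xs \<subseteq> {..n} \<and> length xs \<le> n})"
    by (intro finite_imageI finite_lists_length_le) auto
qed

lemma num_regular_partitions_0: "b\<^bsub>t\<^esub> 0 = 1"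
proof -
  have "regular_partitions t 0 = {{#}}"
  proof (intro equalityI subsetI)
    fix P assume P: "P \<in> regular_partitions t 0"
    have "P = {#}"
    proof (rule ccontr)
      assume "P \<noteq> {#}"
      then obtain k where "k \<in># P" by blast
      thus False using P by (auto simp: regular_partitions_def)
    qed
    thus "P \<in> {{#}}" by simp
  qed (simp add: regular_partitions_def)
  thus ?thesis by (simp add: num_regular_partitions_def)
qed

definition is_alpha :: "nat \<Rightarrow> nat \<Rightarrow> bool" where
  "is_alpha p a \<longleftrightarrow>
     0 < a \<and> a < p\<^sup>2 \<and> [int a = - modular_inverse (int (p\<^sup>2)) 24] (mod int (p\<^sup>2))"

definition alpha :: "nat \<Rightarrow> nat" where
  "alpha p = (THE a. is_alpha p a)"

lemma alpha_unique:
  assumes "prime p" "p > 3"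
  shows "\<exists>!a. is_alpha p a"
proof -
  define m where "m = int (p\<^sup>2)"
  define i where "i = modular_inverse m 24"
  have m: "m > 1" using assms unfolding m_def
    by (metis of_nat_1 of_nat_less_iff one_less_power pos2 prime_gt_1_nat)
  have "\<not> p dvd 24"
  proof
    assume "p dvd 24"
    also have "(24::nat) = 2 ^ 3 * 3" by simp
    finally have "p dvd 2 \<or> p dvd 3"
      using assms(1) by (metis prime_dvd_mult_iff prime_dvd_power)
    thus False using assms(2) by (auto dest: dvd_imp_le)
  qed
  hence "coprime (24::nat) (p\<^sup>2)"
    using assms(1) by (metis coprime_commute coprime_power_right_iff prime_imp_coprime)
  hence cop: "coprime (24::int) m"
    unfolding m_def by (metis coprime_int_iff of_nat_numeral)
  have inv: "[24 * i = 1] (mod m)"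
    unfolding i_def by (rule cong_modular_inverse1[OF cop])
  have i0: "\<not> m dvd i"
  proof
    assume "m dvd i"
    hence "m dvd 24 * i" by simp
    hence "[1 = 0] (mod m)" using inv by (metis cong_0_iff cong_sym cong_trans)
    thus False using m by (simp add: cong_0_iff)
  qed
  have iff: "is_alpha p a \<longleftrightarrow> a = nat ((- i) mod m)" for a
  proof
    assume "is_alpha p a"
    hence "[int a = - i] (mod m)" and "int a < m"
      unfolding is_alpha_def m_def i_def by (blast, simp flip: of_nat_power)
    hence "int a = (- i) mod m"
      unfolding Cong.cong_def by simp
    thus "a = nat ((- i) mod m)"
      by (metis nat_int)
  next
    assume a: "a = nat ((- i) mod m)"
    have "(- i) mod m \<noteq> 0" using i0 by (simp add: dvd_eq_mod_eq_0 [symmetric])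
    moreover have "(- i) mod m \<ge> 0" "(- i) mod m < m" using m by auto
    ultimately have "0 < a" and less: "int a < m" and eq: "int a = (- i) mod m"
      unfolding a by auto
    moreover have "a < p\<^sup>2"
      using less unfolding m_def by linarith
    moreover have "[int a = - i] (mod m)"
      unfolding eq Cong.cong_def by simp
    ultimately show "is_alpha p a"
      unfolding is_alpha_def m_def i_def by blast
  qed
  show ?thesis unfolding iff by blast
qed

definition fps_cong :: "int fps \<Rightarrow> int fps \<Rightarrow> int \<Rightarrow> bool"
    (\<open>(1[_ \<equiv> _] '(fps'_mod _'))\<close>) where
  "[F \<equiv> G] (fps_mod m) \<longleftrightarrow> (\<forall>n. [fps_nth F n = fps_nth G n] (mod m))"

text \<open>
  Density relative to the set of all primes. The quotient is \<open>0 / 0 = 0\<close> for \<open>x < 2\<close>,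
  which does not affect the limit inferior.
\<close>

definition prime_lower_density :: "nat set \<Rightarrow> ereal" where
  "prime_lower_density A =
     liminf (\<lambda>x::nat. ereal (real (card {p\<in>A. prime p \<and> p \<le> x})
                             / real (card {p::nat. prime p \<and> p \<le> x})))"

definition positive_proportion_of_primes :: "(nat \<Rightarrow> bool) \<Rightarrow> bool" where
  "positive_proportion_of_primes Q \<longleftrightarrow> prime_lower_density {p. prime p \<and> Q p} > 0"

end

theory Submission
  imports Defs "HOL-Library.Z2" "HOL-Real_Asymp.Real_Asymp"
begin

text \<open>
  Write \<open>f\<^sub>k = (q\<^sup>k; q\<^sup>k)\<^sub>\<infinity>\<close> for the Euler products over the field with two elements. Three instances of the
  Jacobi triple product together with a 3-dissection of \<open>f\<^sub>1\<^sup>3\<close> give \<open>f\<^sub>1\<^sup>3 = f\<^sub>3 B\<close> with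
  \<open>B = 1 + (\<Sum>m \<ge> 1, 3 \<nmid> m. q^(m\<^sup>2))\<close>. As the generating function of \<open>b\<^sub>3\<close> is \<open>f\<^sub>3 / f\<^sub>1 = f\<^sub>1\<^sup>2 / B\<close>, its
  even part is \<open>f\<^sub>1 B\<close>, so that \<open>b\<^sub>3(2n)\<close> has the parity of the number of representations
  \<open>24 n + 1 = x\<^sup>2 + 24 m\<^sup>2\<close> with \<open>x > 0\<close> and \<open>m = 0\<close> or \<open>m > 0\<close>, \<open>3 \<nmid> m\<close>. If a prime \<open>p\<close> is inert in
  \<open>\<rat>(\<surd>-6)\<close>, that is \<open>p \<equiv> 13, 17, 19, 23 (mod 24)\<close>, then \<open>p\<close> divides such a form only if it divides both
  \<open>x\<close> and \<open>m\<close>, and dividing by \<open>p\<^sup>2\<close> yields the congruence, since \<open>24 \<alpha> + 1 = p\<^sup>2\<close>. The inert primes have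
  positive lower density by an argument of Chebyshev type: the partial sums of the quadratic character of
  discriminant -24 are nonnegative and small.
\<close>

unbundle no vec_syntax
unbundle fps_syntax

section \<open>Truncated equality of power series\<close>

text \<open>In characteristic 2 the signs of the Euler products disappear and squaring is the
  substitution of \<open>q^2\<close> for \<open>q\<close>. So \<open>f_2k = f_k^2\<close>, the eta
  quotients collapse to powers of a few series, and a square factor passes through the extraction of
  even exponents. The triple product is taken only at \<open>z = q^r\<close>, which keeps it an
  identity in one variable and a limit of finite q-binomial sums. On the arithmetic side one has to
  know that -6 is a nonresidue modulo the inert primes, and that these primes are frequent. The
  first comes from a descent: every value \<open>x^2 + 6\<close>, stripped of a suitable divisor of
  6, has character value 1, which a smallest inert divisor would contradict. For the second, the sum
  of \<open>chi k * ln k\<close> weighs split against inert prime powers by partial sums of the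
  character. These are nonnegative and, after 0, vanish first at 23; this positivity plays the part
  of the nonvanishing of L(1, chi). The window from n/23 to n is wide enough for crude Chebyshev
  bounds to leave a positive main term.\<close>

definition trunc_eq :: "nat \<Rightarrow> 'a::comm_ring_1 fps \<Rightarrow> 'a fps \<Rightarrow> bool" where
  "trunc_eq K F G \<longleftrightarrow> (\<forall>i<K. F $ i = G $ i)"

lemma trunc_eq_refl [simp]: "trunc_eq K F F"
  by (simp add: trunc_eq_def)

lemma trunc_eq_sym: "trunc_eq K F G \<Longrightarrow> trunc_eq K G F"
  by (simp add: trunc_eq_def)

lemma trunc_eq_trans [trans]: "trunc_eq K F G \<Longrightarrow> trunc_eq K G H \<Longrightarrow> trunc_eq K F H"
  by (simp add: trunc_eq_def)

lemma trunc_eq_mono: "trunc_eq K F G \<Longrightarrow> K' \<le> K \<Longrightarrow> trunc_eq K' F G"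
  by (simp add: trunc_eq_def)

lemma trunc_eq_mult: "trunc_eq K F G \<Longrightarrow> trunc_eq K F' G' \<Longrightarrow> trunc_eq K (F * F') (G * G')"
  by (auto simp: trunc_eq_def fps_mult_nth intro!: sum.cong)

lemma trunc_eq_sum: "(\<And>x. x \<in> A \<Longrightarrow> trunc_eq K (f x) (g x)) \<Longrightarrow> trunc_eq K (sum f A) (sum g A)"
  by (auto simp: trunc_eq_def fps_sum_nth intro!: sum.cong)

lemma trunc_eq_prod_one: "(\<And>x. x \<in> A \<Longrightarrow> trunc_eq K (f x) 1) \<Longrightarrow> trunc_eq K (prod f A) 1"
proof (induction A rule: infinite_finite_induct)
  case (insert x A)
  have "trunc_eq K (f x * prod f A) (1 * 1)"
    by (intro trunc_eq_mult insert) (use insert in auto)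
  then show ?case using insert by simp
qed auto

text \<open>A factor \<open>fps_X ^ e\<close> raises the precision by \<open>e\<close>. In
  \<open>triple_product\<close> this makes up for the Gaussian coefficients that are close to their
  limit only in low degree.\<close>

lemma trunc_eq_X_power_mult:
  "trunc_eq K F G \<Longrightarrow> trunc_eq (K + e) (fps_X ^ e * F) (fps_X ^ e * G)"
  by (auto simp: trunc_eq_def fps_X_power_mult_nth)

lemma fps_eqI_trunc_eq: "(\<And>K. trunc_eq K F G) \<Longrightarrow> F = G"
  by (auto simp: trunc_eq_def fps_eq_iff)

lemma trunc_eq_cancel_left:
  fixes F G H :: "'a::field fps"
  assumes "trunc_eq K (H * F) (H * G)" "H $ 0 \<noteq> 0"
  shows "trunc_eq K F G"
proof -
  have "trunc_eq K (inverse H * (H * F)) (inverse H * (H * G))"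
    by (intro trunc_eq_mult assms trunc_eq_refl)
  moreover have "inverse H * H = 1" using assms(2) by (simp add: inverse_mult_eq_1)
  ultimately show ?thesis by (simp flip: mult.assoc)
qed

section \<open>Infinite products modulo 2\<close>

definition fps_prod_finite :: "nat set \<Rightarrow> bit fps" where
  "fps_prod_finite A = (\<Prod>a\<in>A. 1 + fps_X ^ a)"

text \<open>Coefficient \<open>n\<close> sees only the factors with exponent at most
  \<open>n\<close>, so the infinite product is read off from finite ones. Indexing by a set turns
  products of such series into disjoint unions.\<close>

definition fps_prod_set :: "nat set \<Rightarrow> bit fps" where
  "fps_prod_set A = Abs_fps (\<lambda>n. fps_prod_finite (A \<inter> {..n}) $ n)"

lemma fps_two_eq_0 [simp]: "(2 :: bit fps) = 0"
  by (simp add: numeral_fps_const)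

lemma bit_fps_add_self [simp]: "F + F = (0 :: bit fps)"
  by (metis fps_two_eq_0 mult_2 mult_zero_left)

lemma bit_fps_minus: "F - G = F + (G :: bit fps)"
  by (simp add: fps_eq_iff)

lemma bit_fps_square_factor: "1 + fps_X ^ (2 * a) = (1 + fps_X ^ a) * (1 + fps_X ^ a :: bit fps)"
proof -
  have "(1 + fps_X ^ a) * (1 + fps_X ^ a :: bit fps) = 1 + (fps_X ^ a + fps_X ^ a) + fps_X ^ a * fps_X ^ a"
    by (simp only: distrib_left distrib_right mult_1_left mult_1_right add.assoc)
  then show ?thesis by (simp add: mult_2 flip: power_add)
qed

lemma trunc_eq_fps_prod_finite:
  assumes "finite A" "B \<subseteq> A" "\<And>a. a \<in> A - B \<Longrightarrow> a \<ge> K"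
  shows "trunc_eq K (fps_prod_finite A) (fps_prod_finite B)"
proof -
  have "fps_prod_finite A = fps_prod_finite (A - B) * fps_prod_finite B"
    unfolding fps_prod_finite_def using assms by (intro prod.subset_diff) auto
  moreover have "trunc_eq K (fps_prod_finite (A - B)) 1"
    unfolding fps_prod_finite_def
  proof (rule trunc_eq_prod_one)
    fix a assume "a \<in> A - B"
    then have "K \<le> a" by (rule assms(3))
    then show "trunc_eq K (1 + fps_X ^ a) (1 :: bit fps)" by (auto simp: trunc_eq_def)
  qed
  ultimately show ?thesis
    using trunc_eq_mult[of K "fps_prod_finite (A - B)" 1 "fps_prod_finite B"] by simp
qed

lemma trunc_eq_fps_prod_set:
  assumes "finite B" "A \<inter> {..<K} \<subseteq> B" "B \<subseteq> A"
  shows "trunc_eq K (fps_prod_set A) (fps_prod_finite B)"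
  unfolding trunc_eq_def
proof (intro allI impI)
  fix i assume i: "i < K"
  have "trunc_eq (Suc i) (fps_prod_finite B) (fps_prod_finite (A \<inter> {..i}))"
    by (rule trunc_eq_fps_prod_finite) (use assms i in auto)
  then show "fps_prod_set A $ i = fps_prod_finite B $ i"
    by (simp add: fps_prod_set_def trunc_eq_def)
qed

lemma fps_prod_set_union:
  assumes "A \<inter> B = {}"
  shows "fps_prod_set (A \<union> B) = fps_prod_set A * fps_prod_set B"
proof (rule fps_eqI_trunc_eq)
  fix K
  have "trunc_eq K (fps_prod_set (A \<union> B)) (fps_prod_finite ((A \<union> B) \<inter> {..<K}))"
    by (rule trunc_eq_fps_prod_set) auto
  also have "fps_prod_finite ((A \<union> B) \<inter> {..<K}) =
      fps_prod_finite (A \<inter> {..<K}) * fps_prod_finite (B \<inter> {..<K})"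
    unfolding fps_prod_finite_def Int_Un_distrib2 using assms
    by (intro prod.union_disjoint) auto
  also have "trunc_eq K \<dots> (fps_prod_set A * fps_prod_set B)"
    by (intro trunc_eq_mult trunc_eq_sym[OF trunc_eq_fps_prod_set]) auto
  finally show "trunc_eq K (fps_prod_set (A \<union> B)) (fps_prod_set A * fps_prod_set B)" .
qed

text \<open>The Frobenius map, applied factor by factor:
  \<open>(1 + q^a)^2 = 1 + q^(2a)\<close>.\<close>

lemma fps_prod_set_square: "fps_prod_set A ^ 2 = fps_prod_set ((\<lambda>a. 2 * a) ` A)"
proof (rule fps_eqI_trunc_eq)
  fix K
  have "trunc_eq K (fps_prod_set A * fps_prod_set A)
      (fps_prod_finite (A \<inter> {..<K}) * fps_prod_finite (A \<inter> {..<K}))"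
    by (intro trunc_eq_mult trunc_eq_fps_prod_set) auto
  also have "fps_prod_finite (A \<inter> {..<K}) * fps_prod_finite (A \<inter> {..<K}) =
      fps_prod_finite ((\<lambda>a. 2 * a) ` (A \<inter> {..<K}))"
    unfolding fps_prod_finite_def
    by (subst prod.reindex) (simp_all add: inj_on_def bit_fps_square_factor flip: prod.distrib)
  also have "trunc_eq K \<dots> (fps_prod_set ((\<lambda>a. 2 * a) ` A))"
    by (intro trunc_eq_sym[OF trunc_eq_fps_prod_set]) auto
  finally show "trunc_eq K (fps_prod_set A ^ 2) (fps_prod_set ((\<lambda>a. 2 * a) ` A))"
    by (simp add: power2_eq_square)
qed

lemma fps_prod_set_nth_0: 
  assumes "0 \<notin> A"
  shows "fps_prod_set A $ 0 = 1"
proof -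
  have "A \<inter> {..0} = {}" using assms by auto
  then show ?thesis by (simp add: fps_prod_set_def fps_prod_finite_def)
qed

lemma fps_prod_set_nonzero: "0 \<notin> A \<Longrightarrow> fps_prod_set A \<noteq> 0"
  using fps_prod_set_nth_0 by force

section \<open>Gaussian binomial coefficients\<close>

text \<open>The q-Pascal recurrence, unlike a quotient of q-factorials, makes sense in every
  commutative ring, in particular at \<open>q = fps_X ^ M\<close>.\<close>

fun qbinomial :: "'a::comm_ring_1 \<Rightarrow> nat \<Rightarrow> nat \<Rightarrow> 'a" where
  "qbinomial q n 0 = 1"
| "qbinomial q 0 (Suc k) = 0"
| "qbinomial q (Suc n) (Suc k) = q ^ Suc k * qbinomial q n (Suc k) + qbinomial q n k"

lemma qbinomial_eq_0: "n < k \<Longrightarrow> qbinomial q n k = 0"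
proof (induction n arbitrary: k)
  case 0 then show ?case by (cases k) auto
next
  case (Suc n) then show ?case by (cases k) auto
qed

lemma triangle_Suc: "Suc k * k div 2 = k + k * (k - 1) div 2"
proof -
  have "Suc k * k = k * (k - 1) + 2 * k" by (cases k) (auto simp: algebra_simps)
  then show ?thesis by simp
qed

text \<open>Peeling off the factor with \<open>i = 0\<close> turns \<open>x\<close> into
  \<open>x * q\<close> in the others, hence the induction for arbitrary \<open>x\<close>. The form
  homogeneous in \<open>x\<close> and \<open>y\<close> lets \<open>finite_triple_product\<close>
  choose a \<open>y\<close> that avoids negative exponents.\<close>

theorem qbinomial_theorem:
  "(\<Prod>i<n. y + x * q ^ i) =
     (\<Sum>k\<le>n. q ^ (k * (k - 1) div 2) * qbinomial q n k * x ^ k * y ^ (n - k))"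
proof (induction n arbitrary: x)
  case 0 then show ?case by simp
next
  case (Suc n)
  define t where "t k = q ^ (k * (k - 1) div 2)" for k :: nat
  have t_Suc: "t (Suc k) = q ^ k * t k" for k
    unfolding t_def using triangle_Suc[of k] by (simp only: diff_Suc_1 power_add)
  define f where "f k = t k * qbinomial q n k * (x * q) ^ k * y ^ (n - k)" for k
  have "(\<Prod>i<Suc n. y + x * q ^ i) = (y + x) * (\<Prod>i<n. y + (x * q) * q ^ i)"
    by (subst prod.lessThan_Suc_shift) (simp add: mult.assoc)
  also have "\<dots> = (y + x) * (\<Sum>k\<le>n. f k)"
    unfolding Suc f_def t_def ..
  also have "\<dots> = (\<Sum>k\<le>n. y * f k) + (\<Sum>k\<le>n. x * f k)"
    by (subst distrib_right) (simp only: sum_distrib_left)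
  also have "(\<Sum>k\<le>n. y * f k) = y * f 0 + (\<Sum>k\<le>n. y * f (Suc k))"
  proof -
    have "(\<Sum>k\<le>n. y * f k) = (\<Sum>k\<le>Suc n. y * f k)"
      by (simp add: f_def qbinomial_eq_0)
    then show ?thesis by (simp add: sum.atMost_Suc_shift del: sum.atMost_Suc)
  qed
  also have "y * f 0 + (\<Sum>k\<le>n. y * f (Suc k)) + (\<Sum>k\<le>n. x * f k) =
      y * f 0 + (\<Sum>k\<le>n. y * f (Suc k) + x * f k)"
    by (simp add: sum.distrib)
  also have "y * f 0 = t 0 * qbinomial q (Suc n) 0 * x ^ 0 * y ^ (Suc n - 0)"
    by (simp add: f_def)
  also have "(\<Sum>k\<le>n. y * f (Suc k) + x * f k) =
      (\<Sum>k\<le>n. t (Suc k) * qbinomial q (Suc n) (Suc k) * x ^ Suc k * y ^ (Suc n - Suc k))"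
  proof (rule sum.cong)
    fix k assume "k \<in> {..n}"
    show "y * f (Suc k) + x * f k =
        t (Suc k) * qbinomial q (Suc n) (Suc k) * x ^ Suc k * y ^ (Suc n - Suc k)"
    \<comment> \<open>With truncated subtraction, \<open>y * y ^ (n - Suc k)\<close> is
      \<open>y ^ (n - k)\<close> only for \<open>k < n\<close>; at \<open>k = n\<close> the
      coefficient \<open>qbinomial q n (Suc n)\<close> vanishes instead.\<close>
    proof (cases "k = n")
      case True
      then show ?thesis
        by (simp add: f_def qbinomial_eq_0 t_Suc algebra_simps power_mult_distrib)
    next
      case False
      then have "n - k = Suc (n - Suc k)" using \<open>k \<in> {..n}\<close> by auto
      then show ?thesis
        by (simp add: f_def t_Suc algebra_simps power_mult_distrib)
    qed
  qed simp
  also have "t 0 * qbinomial q (Suc n) 0 * x ^ 0 * y ^ (Suc n - 0) + \<dots> =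
      (\<Sum>k\<le>Suc n. t k * qbinomial q (Suc n) k * x ^ k * y ^ (Suc n - k))"
    by (subst sum.atMost_Suc_shift) simp
  finally show ?case unfolding t_def .
qed

text \<open>Cleared of denominators, since the factors \<open>1 - q ^ i\<close> may fail to be
  units. The induction step is
  \<open>q^(l+1) (1 - q^(n-l)) + (1 - q^(l+1)) = 1 - q^(n+1)\<close>.\<close>

lemma qbinomial_fact:
  assumes "k \<le> n"
  shows "qbinomial q n k * (\<Prod>i=1..k. 1 - q ^ i) * (\<Prod>i=1..n - k. 1 - q ^ i) = (\<Prod>i=1..n. 1 - q ^ i)"
  using assms
proof (induction n arbitrary: k)
  case 0 then show ?case by simp
next
  case (Suc n)
  define P where "P m = (\<Prod>i=1..m. 1 - q ^ i)" for m
  have P_Suc: "P (Suc m) = P m * (1 - q ^ Suc m)" for m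
    unfolding P_def by simp
  have IH: "qbinomial q n k * P k * P (n - k) = P n" if "k \<le> n" for k
    using Suc.IH that unfolding P_def .
  show ?case
  proof (cases k)
    case 0 then show ?thesis by simp
  next
    case (Suc l)
    then have l: "l \<le> n" using Suc.prems by simp
    have "q ^ Suc l * qbinomial q n (Suc l) * P (Suc l) * P (n - l) =
        q ^ Suc l * (1 - q ^ (n - l)) * P n"
    proof (cases "l = n")
      case True then show ?thesis by (simp add: qbinomial_eq_0)
    next
      case False
      then have "P (n - l) = P (n - Suc l) * (1 - q ^ (n - l))"
        using l P_Suc[of "n - Suc l"] by (simp add: Suc_diff_Suc)
      then have "q ^ Suc l * qbinomial q n (Suc l) * P (Suc l) * P (n - l) =
          q ^ Suc l * (1 - q ^ (n - l)) * (qbinomial q n (Suc l) * P (Suc l) * P (n - Suc l))"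
        by (simp only: mult_ac)
      then show ?thesis using IH[of "Suc l"] False l by simp
    qed
    moreover have "qbinomial q n l * P (Suc l) * P (n - l) = (1 - q ^ Suc l) * P n"
      by (simp add: P_Suc mult_ac flip: IH[OF l])
    moreover have "q ^ Suc l * q ^ (n - l) = q ^ Suc n"
      using l by (simp del: power_Suc flip: power_add)
    ultimately have "qbinomial q (Suc n) (Suc l) * P (Suc l) * P (n - l) = (1 - q ^ Suc n) * P n"
      by (simp add: distrib_right distrib_left left_diff_distrib right_diff_distrib flip: mult.assoc)
    then show ?thesis using Suc P_Suc[of n] unfolding P_def by (simp add: mult.commute)
  qed
qed

section \<open>The Jacobi triple product modulo 2\<close>

definition theta_exponent :: "int \<Rightarrow> int \<Rightarrow> int \<Rightarrow> int" where
  "theta_exponent m r j = m * (j * (j - 1) div 2) + r * j"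

text \<open>The sum of \<open>q^(theta_exponent m r j)\<close> over all integers \<open>j\<close>,
  which is the sum side of the Jacobi triple product with base \<open>q^m\<close> at
  \<open>z = q^r\<close>. The fibres are finite for \<open>0 < r < m\<close>.\<close>

definition theta :: "int \<Rightarrow> int \<Rightarrow> bit fps" where
  "theta m r = Abs_fps (\<lambda>n. of_nat (card {j. theta_exponent m r j = int n}))"

lemma two_times_triangle: "2 * (j * (j - 1) div 2) = j * (j - 1)" for j :: int
  by simp

lemma theta_exponent_double: "2 * theta_exponent m r j = m * (j * (j - 1)) + 2 * r * j"
proof -
  have "2 * theta_exponent m r j = m * (2 * (j * (j - 1) div 2)) + 2 * r * j"
    unfolding theta_exponent_def by (simp only: distrib_left mult_ac)
  then show ?thesis by (simp only: two_times_triangle)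
qed

text \<open>For \<open>j >= 0\<close> the bound comes from \<open>r >= 1\<close>, for
  \<open>j < 0\<close> from \<open>m - r >= 1\<close>. It makes the fibres in \<open>theta\<close>
  finite and confines the indices that matter below degree \<open>N\<close> to
  \<open>|j| < N\<close>.\<close>

lemma theta_exponent_ge_abs:
  assumes "0 < r" "r < m"
  shows "\<bar>j\<bar> \<le> theta_exponent m r j"
proof (cases "j \<ge> 0")
  case True
  have "0 \<le> j * (j - 1)" using True by (cases "j = 0") auto
  then have "0 \<le> m * (j * (j - 1))" using assms by simp
  moreover have "j \<le> r * j" using True assms by (simp add: mult_le_cancel_right1)
  ultimately show ?thesis using theta_exponent_double[of m r j] True by linarith
next
  case False
  have "0 \<le> j * (j + 1)" using False by (simp add: zero_le_mult_iff)
  then have "0 \<le> m * (j * (j + 1))" using assms by simp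
  moreover have "(m - 1) * j \<le> r * j" using False assms by (intro mult_right_mono_neg) auto
  ultimately show ?thesis using theta_exponent_double[of m r j] False
    by (simp add: algebra_simps)
qed

lemma finite_theta_exponent:
  assumes "0 < r" "r < m"
  shows "finite {j. theta_exponent m r j = n}"
proof (rule finite_subset)
  show "{j. theta_exponent m r j = n} \<subseteq> {-n..n}"
    using theta_exponent_ge_abs[OF assms] by (auto simp: abs_le_iff) (smt (verit))+
qed auto

text \<open>Recentres the q-binomial sum at \<open>j = k - N\<close>: a constant, cancelled later,
  plus the exponent of the theta series. The proof doubles everything to remove the divisions by
  2.\<close>

lemma triple_product_exponent:
  fixes M r N k :: nat
  assumes r: "0 < r" "r < M" and k: "k \<le> 2 * N"
  shows "M * (k * (k - 1) div 2) + r * k + M * N * (2 * N - k) =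
    (r * N + M * (N * (N - 1) div 2) + M * N * N) +
      nat (theta_exponent (int M) (int r) (int k - int N))"
proof -
  define T where "T n = n * (n - 1) div 2" for n :: nat
  have T: "2 * int (T n) = int n * (int n - 1)" for n
  proof -
    have "even (n * (n - 1))" by (cases n) auto
    then have "2 * T n = n * (n - 1)" unfolding T_def by (rule dvd_mult_div_cancel)
    then have "int (2 * T n) = int (n * (n - 1))" by simp
    then show ?thesis by (cases n) (auto simp: algebra_simps)
  qed
  define j where "j = int k - int N"
  have nonneg: "0 \<le> theta_exponent (int M) (int r) j"
    using theta_exponent_ge_abs[of "int r" "int M" j] r by linarith
  have kk: "int (2 * N - k) = 2 * int N - int k" using k by simp
  have "2 * int (M * T k + r * k + M * N * (2 * N - k)) =
      int M * (2 * int (T k)) + 2 * int r * int k + 2 * int M * int N * (2 * int N - int k)"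
    by (simp only: of_nat_add of_nat_mult kk) (simp add: algebra_simps)
  also have "\<dots> = 2 * int r * int N + int M * (2 * int (T N)) + 2 * int M * int N * int N +
      2 * theta_exponent (int M) (int r) j"
    unfolding T theta_exponent_double j_def by (simp add: algebra_simps)
  also have "\<dots> = 2 * int ((r * N + M * T N + M * N * N) + nat (theta_exponent (int M) (int r) j))"
    using nonneg by (simp add: algebra_simps)
  finally have "int (M * T k + r * k + M * N * (2 * N - k)) =
      int ((r * N + M * T N + M * N * N) + nat (theta_exponent (int M) (int r) j))"
    by (rule mult_left_cancel[THEN iffD1, rotated]) simp
  then show ?thesis unfolding T_def j_def by (simp only: of_nat_eq_iff)
qed

lemma sum_arith_progression: "(\<Sum>i<N. r + M * i) = r * N + M * (N * (N - 1) div 2)" for r M N :: nat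
proof -
  have "(\<Sum>i<N. i) = N * (N - 1) div 2"
    using Sum_Ico_nat[of 0 N] by (simp add: atLeast0LessThan)
  then show ?thesis by (simp add: sum.distrib flip: sum_distrib_left)
qed

text \<open>The q-binomial theorem with \<open>2N\<close> factors, base \<open>X^M\<close>,
  \<open>x = X^r\<close> and \<open>y = X^(MN)\<close>. The first \<open>N\<close> factors are
  \<open>X^(r+Mi) (1 + X^(M(N-i)-r))\<close>, the last \<open>N\<close> are
  \<open>X^(MN) (1 + X^(r+Mi))\<close>; the powers of \<open>X\<close> taken out multiply to
  \<open>X^E\<close>, which divides every term of the sum as well.\<close>

lemma finite_triple_product:
  fixes M r N :: nat
  assumes r: "0 < r" "r < M"
  defines "e \<equiv> \<lambda>k. nat (theta_exponent (int M) (int r) (int k - int N))"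
  shows "(\<Prod>i<N. 1 + fps_X ^ (M * (N - i) - r)) * (\<Prod>i<N. 1 + fps_X ^ (r + M * i)) =
    (\<Sum>k\<le>2*N. fps_X ^ e k * qbinomial (fps_X ^ M) (2 * N) k :: 'a::idom fps)"
    (is "?P1 * ?P2 = ?S")
proof -
  let ?X = "fps_X :: 'a fps"
  define E where "E = r * N + M * (N * (N - 1) div 2) + M * N * N"
  have "(\<Prod>i<2*N. ?X ^ (M * N) + ?X ^ r * (?X ^ M) ^ i) =
      (\<Prod>i<N. ?X ^ (M * N) + ?X ^ (r + M * i)) * (\<Prod>i<N. ?X ^ (M * N) + ?X ^ (r + M * (i + N)))"
  proof -
    have split: "(\<Prod>i<2*N. f i) = (\<Prod>i<N. f i) * (\<Prod>i<N. f (i + N))" for f :: "nat \<Rightarrow> 'a fps"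
    proof -
      have "(\<Prod>i<2*N. f i) = (\<Prod>i<N. f i) * (\<Prod>i=N..<2*N. f i)"
        by (simp add: prod.atLeastLessThan_concat flip: atLeast0LessThan)
      also have "(\<Prod>i=N..<2*N. f i) = (\<Prod>i<N. f (i + N))"
        using prod.shift_bounds_nat_ivl[of f 0 N N] by (simp add: atLeast0LessThan mult_2)
      finally show ?thesis .
    qed
    show ?thesis by (simp only: split power_add power_mult)
  qed
  also have "(\<Prod>i<N. ?X ^ (M * N) + ?X ^ (r + M * i)) = (\<Prod>i<N. ?X ^ (r + M * i)) * ?P1"
  proof (subst prod.distrib[symmetric], rule prod.cong)
    fix i assume "i \<in> {..<N}"
    then have "M * i + M \<le> M * N" 
      by (metis Suc_leI lessThan_iff mult.commute mult_Suc_right mult_le_mono2 add.commute)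
    then have eq: "M * N = (r + M * i) + (M * (N - i) - r)"
      using r by (simp add: right_diff_distrib')
    show "?X ^ (M * N) + ?X ^ (r + M * i) = ?X ^ (r + M * i) * (1 + ?X ^ (M * (N - i) - r))"
      unfolding eq power_add[of ?X "r + M * i"] by (simp add: distrib_left add.commute)
  qed simp
  also have "(\<Prod>i<N. ?X ^ (M * N) + ?X ^ (r + M * (i + N))) = (\<Prod>i<N. ?X ^ (M * N)) * ?P2"
    by (subst prod.distrib[symmetric], rule prod.cong) (simp_all add: algebra_simps power_add)
  also have "(\<Prod>i<N. ?X ^ (r + M * i)) * ?P1 * ((\<Prod>i<N. ?X ^ (M * N)) * ?P2) = ?X ^ E * (?P1 * ?P2)"
  proof -
    have "(\<Prod>i<N. ?X ^ (r + M * i)) * (\<Prod>i<N. ?X ^ (M * N)) = ?X ^ E"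
      unfolding power_sum[symmetric] sum_arith_progression E_def
      by (simp only: power_add power_mult sum_constant card_lessThan mult.commute[of "card _"] of_nat_id
          mult.commute[of N "M * N"])
    moreover have "(\<Prod>i<N. ?X ^ (r + M * i)) * ?P1 * ((\<Prod>i<N. ?X ^ (M * N)) * ?P2) =
        ((\<Prod>i<N. ?X ^ (r + M * i)) * (\<Prod>i<N. ?X ^ (M * N))) * (?P1 * ?P2)"
      by (simp only: mult_ac)
    ultimately show ?thesis by (simp only:)
  qed
  finally have "?X ^ E * (?P1 * ?P2) = (\<Prod>i<2*N. ?X ^ (M * N) + ?X ^ r * (?X ^ M) ^ i)" ..
  also have "\<dots> = (\<Sum>k\<le>2*N. (?X ^ M) ^ (k * (k - 1) div 2) * qbinomial (?X ^ M) (2*N) k *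
      (?X ^ r) ^ k * (?X ^ (M * N)) ^ (2 * N - k))"
    by (rule qbinomial_theorem)
  also have "\<dots> = (\<Sum>k\<le>2*N. ?X ^ E * (?X ^ e k * qbinomial (?X ^ M) (2*N) k))"
  proof (rule sum.cong)
    fix k assume "k \<in> {..2*N}"
    then have "M * (k * (k - 1) div 2) + r * k + M * N * (2 * N - k) = E + e k"
      unfolding E_def e_def by (intro triple_product_exponent r) auto
    then have "?X ^ (M * (k * (k - 1) div 2) + r * k + M * N * (2 * N - k)) = ?X ^ (E + e k)"
      by simp
    then have *: "(?X ^ M) ^ (k * (k - 1) div 2) * (?X ^ r) ^ k * (?X ^ (M * N)) ^ (2 * N - k) =
        ?X ^ E * ?X ^ e k"
      by (simp only: power_add power_mult)
    have "(?X ^ M) ^ (k * (k - 1) div 2) * qbinomial (?X ^ M) (2*N) k *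
        (?X ^ r) ^ k * (?X ^ (M * N)) ^ (2 * N - k) =
        ((?X ^ M) ^ (k * (k - 1) div 2) * (?X ^ r) ^ k * (?X ^ (M * N)) ^ (2 * N - k)) *
        qbinomial (?X ^ M) (2*N) k"
      by (simp only: mult_ac)
    then show "(?X ^ M) ^ (k * (k - 1) div 2) * qbinomial (?X ^ M) (2*N) k *
      (?X ^ r) ^ k * (?X ^ (M * N)) ^ (2 * N - k) = ?X ^ E * (?X ^ e k * qbinomial (?X ^ M) (2*N) k)"
      unfolding * by (simp only: mult.assoc)
  qed simp
  also have "\<dots> = ?X ^ E * ?S" by (rule sum_distrib_left[symmetric])
  finally show ?thesis by simp
qed

lemma fps_prod_nth_0: "prod f A $ 0 = (\<Prod>x\<in>A. f x $ 0)" for f :: "'b \<Rightarrow> 'a::comm_ring_1 fps"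
  by (induction A rule: infinite_finite_induct) auto

text \<open>By \<open>qbinomial_fact\<close> the coefficient is
  \<open>P (2N) / (P k * P (2N-k))\<close>, and all \<open>P n\<close> with
  \<open>n >= m = min k (2N-k)\<close> agree up to degree \<open>m\<close>.\<close>

lemma trunc_eq_qbinomial:
  fixes M N k :: nat
  assumes "M > 0" "k \<le> 2 * N"
  defines "P \<equiv> \<lambda>n. (\<Prod>i=1..n. 1 - (fps_X ^ M) ^ i :: 'a::field fps)"
  shows "trunc_eq (Suc (min k (2 * N - k))) (P N * qbinomial (fps_X ^ M) (2 * N) k) 1"
proof -
  define m where "m = min k (2 * N - k)"
  have P: "trunc_eq (Suc m) (P n) (P m)" if "n \<ge> m" for n
  proof -
    have "{1..n} = {1..m} \<union> {m<..n}" using that by auto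
    then have "P n = P m * (\<Prod>i\<in>{m<..n}. 1 - (fps_X ^ M) ^ i)"
      unfolding P_def by (simp add: prod.union_disjoint ivl_disj_int)
    moreover have "trunc_eq (Suc m) (\<Prod>i\<in>{m<..n}. 1 - (fps_X ^ M) ^ i :: 'a fps) 1"
    proof (rule trunc_eq_prod_one)
      fix i assume i: "i \<in> {m<..n}"
      have "m < i" using i by simp
      also have "i \<le> M * i" using assms(1) by (cases M) auto
      finally have "m < M * i" .
      then show "trunc_eq (Suc m) (1 - (fps_X ^ M) ^ i :: 'a fps) 1"
        by (auto simp: trunc_eq_def simp flip: power_mult)
    qed
    ultimately show ?thesis
      using trunc_eq_mult[of "Suc m" "P m" "P m" _ 1] by simp
  qed
  have P0: "P m $ 0 \<noteq> 0"
    using assms(1) by (simp add: P_def fps_prod_nth_0 flip: power_mult)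
  define B where "B = qbinomial (fps_X ^ M :: 'a fps) (2 * N) k"
  have "B * P k * P (2 * N - k) = P (2 * N)"
    using qbinomial_fact[OF assms(2)] unfolding B_def P_def .
  moreover have "trunc_eq (Suc m) (B * P k * P (2 * N - k)) (B * P m * P m)"
    by (intro trunc_eq_mult P trunc_eq_refl) (auto simp: m_def)
  moreover have "trunc_eq (Suc m) (P (2 * N)) (P m)" by (rule P) (auto simp: m_def)
  ultimately have "trunc_eq (Suc m) (P m * (P m * B)) (P m * 1)"
    by (metis mult.commute mult.left_commute mult.right_neutral trunc_eq_sym trunc_eq_trans)
  then have "trunc_eq (Suc m) (P m * B) 1"
    using P0 by (rule trunc_eq_cancel_left)
  moreover have "trunc_eq (Suc m) (P N * B) (P m * B)"
    using assms(2) by (intro trunc_eq_mult P trunc_eq_refl) (auto simp: m_def)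
  ultimately show ?thesis unfolding B_def m_def by (rule trunc_eq_trans[rotated])
qed

text \<open>The limit of \<open>finite_triple_product\<close> after multiplication by
  \<open>P\<close>, the part with residue 0. The hypothesis \<open>2 * r \<noteq> M\<close> keeps
  \<open>r\<close> and \<open>M - r\<close> apart, because a set cannot list an exponent
  twice.\<close>

theorem triple_product:
  fixes M r :: nat
  assumes r: "0 < r" "r < M" "2 * r \<noteq> M"
  shows "fps_prod_set {n. 0 < n \<and> n mod M \<in> {0, r, M - r}} = theta (int M) (int r)"
    (is "fps_prod_set ?A = _")
proof (rule fps_eqI_trunc_eq)
  fix N :: nat
  let ?X = "fps_X :: bit fps"
  define e where "e k = nat (theta_exponent (int M) (int r) (int k - int N))" for k
  define P where "P = (\<Prod>i=1..N. 1 - (?X ^ M) ^ i)"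
  define S0 where "S0 = (\<lambda>i. M * i) ` {1..N}"
  define S1 where "S1 = (\<lambda>i. M * (N - i) - r) ` {..<N}"
  define S2 where "S2 = (\<lambda>i. r + M * i) ` {..<N}"
  \<comment> \<open>Reversing the index, \<open>i\<close> to \<open>N - 1 - i\<close>, exhibits
    \<open>S1\<close> in the residue class of \<open>M - r\<close>.\<close>
  have S1_alt: "S1 = (\<lambda>i. (M - r) + M * i) ` {..<N}"
  proof -
    have "M * (N - i) - r = (M - r) + M * (N - Suc i)" if "i < N" for i
    proof -
      have "N - i = Suc (N - Suc i)" using that by simp
      then show ?thesis using r by simp
    qed
    then have "S1 = (\<lambda>i. (M - r) + M * (N - Suc i)) ` {..<N}"
      unfolding S1_def by (intro image_cong) auto
    also have "\<dots> = (\<lambda>i. (M - r) + M * i) ` ((\<lambda>i. N - Suc i) ` {..<N})"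
      by (simp add: image_image)
    also have "(\<lambda>i. N - Suc i) ` {..<N} = {..<N}"
    proof (intro equalityI subsetI)
      fix i assume "i \<in> {..<N}"
      then show "i \<in> (\<lambda>i. N - Suc i) ` {..<N}" by (intro image_eqI[of _ _ "N - Suc i"]) auto
    qed auto
    finally show ?thesis .
  qed
  have mod0: "n mod M = 0" if "n \<in> S0" for n using that by (auto simp: S0_def)
  have mod1: "n mod M = M - r" if "n \<in> S1" for n
  proof -
    obtain i where "n = (M - r) + M * i" using \<open>n \<in> S1\<close> unfolding S1_alt by blast
    then have "n mod M = (M - r) mod M" by (simp only: mod_mult_self2)
    then show ?thesis using r by simp
  qed
  have mod2: "n mod M = r" if "n \<in> S2" for n using that r by (auto simp: S2_def)
  have disj: "S0 \<inter> S1 = {}" "(S0 \<union> S1) \<inter> S2 = {}"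
  proof -
    have "n \<notin> S1" "n \<notin> S2" if "n \<in> S0" for n
      using mod0[OF that] mod1[of n] mod2[of n] r by auto
    moreover have "n \<notin> S2" if "n \<in> S1" for n
      using mod1[OF that] mod2[of n] r by auto
    ultimately show "S0 \<inter> S1 = {}" "(S0 \<union> S1) \<inter> S2 = {}" by blast+
  qed
  have fin: "finite S0" "finite S1" "finite S2" by (auto simp: S0_def S1_def S2_def)
  have "trunc_eq N (fps_prod_set ?A) (fps_prod_finite (S0 \<union> S1 \<union> S2))"
  proof (rule trunc_eq_fps_prod_set)
    show "S0 \<union> S1 \<union> S2 \<subseteq> ?A"
      using mod0 mod1 mod2 r by (auto simp: S0_def S1_alt S2_def)
    show "?A \<inter> {..<N} \<subseteq> S0 \<union> S1 \<union> S2"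
    proof
      fix n assume n: "n \<in> ?A \<inter> {..<N}"
      have le: "n div M < N" using n r by (auto intro: le_less_trans[OF div_le_dividend])
      have eq: "n = n mod M + M * (n div M)" by simp
      consider "n mod M = 0" | "n mod M = r" | "n mod M = M - r" using n by auto
      then show "n \<in> S0 \<union> S1 \<union> S2"
      proof cases
        case 1
        then have "n = M * (n div M)" using eq by simp
        moreover have "n div M \<in> {1..N}" using n le calculation by (cases "n div M") auto
        ultimately show ?thesis unfolding S0_def by blast
      next
        case 2 then show ?thesis using eq le unfolding S2_def by (metis UnI2 imageI lessThan_iff)
      next
        case 3 then show ?thesis using eq le unfolding S1_alt by (metis UnI1 UnI2 imageI lessThan_iff)
      qed
    qed
  qed (use fin in auto)
  also have "fps_prod_finite (S0 \<union> S1 \<union> S2) =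
      (\<Prod>a\<in>S0. 1 + ?X ^ a) * (\<Prod>a\<in>S1. 1 + ?X ^ a) * (\<Prod>a\<in>S2. 1 + ?X ^ a)"
    unfolding fps_prod_finite_def using disj fin by (simp add: prod.union_disjoint)
  also have "(\<Prod>a\<in>S0. 1 + ?X ^ a) = P"
    unfolding S0_def P_def using r
    by (subst prod.reindex) (auto simp: inj_on_def bit_fps_minus power_mult)
  also have "(\<Prod>a\<in>S1. 1 + ?X ^ a) = (\<Prod>i<N. 1 + ?X ^ (M * (N - i) - r))"
    unfolding S1_def
  proof (subst prod.reindex)
    show "inj_on (\<lambda>i. M * (N - i) - r) {..<N}"
    proof (rule inj_onI)
      fix i j assume ij: "i \<in> {..<N}" "j \<in> {..<N}" and eq: "M * (N - i) - r = M * (N - j) - r"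
      have "M * (N - i) \<ge> M * 1" "M * (N - j) \<ge> M * 1" using ij by (intro mult_left_mono; simp)+
      then have "M * (N - i) = M * (N - j)" using eq r by linarith
      then have "N - i = N - j" using r by simp
      then show "i = j" using ij by auto
    qed
  qed (simp add: o_def)
  also have "(\<Prod>a\<in>S2. 1 + ?X ^ a) = (\<Prod>i<N. 1 + ?X ^ (r + M * i))"
    unfolding S2_def using r by (subst prod.reindex) (auto simp: inj_on_def)
  also have "P * (\<Prod>i<N. 1 + ?X ^ (M * (N - i) - r)) * (\<Prod>i<N. 1 + ?X ^ (r + M * i)) =
      (\<Sum>k\<le>2*N. ?X ^ e k * (P * qbinomial (?X ^ M) (2 * N) k))"
    unfolding e_def
    by (simp add: mult.assoc finite_triple_product[OF r(1,2)] sum_distrib_left mult.left_commute)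
  also have "trunc_eq N \<dots> (\<Sum>k\<le>2*N. ?X ^ e k * 1)"
  proof (intro trunc_eq_sum)
    fix k assume "k \<in> {..2*N}"
    then have k: "k \<le> 2 * N" by simp
    define m where "m = min k (2 * N - k)"
    have "trunc_eq (Suc m + e k) (?X ^ e k * (P * qbinomial (?X ^ M) (2 * N) k)) (?X ^ e k * 1)"
      unfolding m_def P_def using r k by (intro trunc_eq_X_power_mult trunc_eq_qbinomial) auto
    \<comment> \<open>Here \<open>m = N - |k - N|\<close> and \<open>e k >= |k - N|\<close>: the
      precision that the Gaussian coefficient loses away from the centre is regained from the
      shift.\<close>
    moreover have "N \<le> Suc m + e k"
      using theta_exponent_ge_abs[of "int r" "int M" "int k - int N"] r k
      unfolding m_def e_def by linarith
    ultimately show "trunc_eq N (?X ^ e k * (P * qbinomial (?X ^ M) (2 * N) k)) (?X ^ e k * 1)"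
      by (rule trunc_eq_mono)
  qed
  also have "trunc_eq N (\<Sum>k\<le>2*N. ?X ^ e k * 1) (theta (int M) (int r))"
    unfolding trunc_eq_def
  proof (intro allI impI)
    fix n assume n: "n < N"
    have ge: "\<bar>j\<bar> \<le> theta_exponent (int M) (int r) j" for j
      using r by (intro theta_exponent_ge_abs) auto
    have "(\<Sum>k\<le>2*N. ?X ^ e k * 1) $ n = (\<Sum>k\<le>2*N. of_bool (e k = n))"
      by (simp add: fps_sum_nth of_bool_def eq_commute)
    also have "\<dots> = of_nat (card {k \<in> {..2*N}. e k = n})"
      by (simp add: Int_def)
    also have "card {k \<in> {..2*N}. e k = n} = card {j. theta_exponent (int M) (int r) j = int n}"
    proof (rule bij_betw_same_card, rule bij_betw_byWitness[where f' = "\<lambda>j. nat (j + int N)"])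
      show "(\<lambda>k. int k - int N) ` {k \<in> {..2*N}. e k = n} \<subseteq>
          {j. theta_exponent (int M) (int r) j = int n}"
        unfolding e_def using order.trans[OF abs_ge_zero ge] by auto
      show "(\<lambda>j. nat (j + int N)) ` {j. theta_exponent (int M) (int r) j = int n} \<subseteq>
          {k \<in> {..2*N}. e k = n}"
      proof (rule image_subsetI)
        fix j assume "j \<in> {j. theta_exponent (int M) (int r) j = int n}"
        then have j: "theta_exponent (int M) (int r) j = int n" by simp
        then have "\<bar>j\<bar> < int N" using ge[of j] n by linarith
        then show "nat (j + int N) \<in> {k \<in> {..2*N}. e k = n}"
          using j unfolding e_def by auto
      qed
      show "\<forall>j\<in>{j. theta_exponent (int M) (int r) j = int n}. int (nat (j + int N)) - int N = j"
        using ge n by (smt (verit) mem_Collect_eq int_nat_eq of_nat_less_iff)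
    qed auto
    finally show "(\<Sum>k\<le>2*N. ?X ^ e k * 1) $ n = theta (int M) (int r) $ n"
      by (simp add: theta_def)
  qed
  finally show "trunc_eq N (fps_prod_set ?A) (theta (int M) (int r))" .
qed

section \<open>Eta quotients modulo 2\<close>

definition euler_prod :: "nat \<Rightarrow> bit fps" where
  "euler_prod c = fps_prod_set {n. 0 < n \<and> c dvd n}"

lemma euler_prod_nonzero: "euler_prod c \<noteq> 0"
  unfolding euler_prod_def by (rule fps_prod_set_nonzero) simp

lemma euler_prod_double:
  assumes "c > 0"
  shows "euler_prod (2 * c) = euler_prod c ^ 2"
proof -
  have "(\<lambda>a. 2 * a) ` {n. 0 < n \<and> c dvd n} = {n. 0 < n \<and> 2 * c dvd n}"
    by (auto elim!: dvdE simp: image_iff)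
  then show ?thesis unfolding euler_prod_def fps_prod_set_square by simp
qed

text \<open>Euler's pentagonal number theorem modulo 2: the residues 0, c, 2c modulo 3c exhaust the
  multiples of c.\<close>

lemma theta_3:
  assumes "c > 0"
  shows "theta (3 * int c) (int c) = euler_prod c"
proof -
  have "n mod (3 * c) \<in> {0, c, 3 * c - c} \<longleftrightarrow> c dvd n" for n
  proof
    assume "n mod (3 * c) \<in> {0, c, 3 * c - c}"
    then have "c dvd n mod (3 * c)" by auto
    then show "c dvd n" by (simp add: dvd_mod_iff)
  next
    assume "c dvd n"
    then obtain m where m: "n = c * m" ..
    have "m mod 3 = 0 \<or> m mod 3 = 1 \<or> m mod 3 = 2" by auto
    moreover have "n mod (3 * c) = c * (m mod 3)" unfolding m by (simp add: mult.commute mod_mult_mult2)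
    ultimately show "n mod (3 * c) \<in> {0, c, 3 * c - c}" by auto
  qed
  moreover have "fps_prod_set {n. 0 < n \<and> n mod (3 * c) \<in> {0, c, 3 * c - c}} =
      theta (int (3 * c)) (int c)"
    by (rule triple_product) (use assms in auto)
  ultimately show ?thesis by (simp add: euler_prod_def)
qed

text \<open>Jacobi's identity for the cube. The residues 0, c, 3c modulo 4c omit the odd multiples
  of 2c, so the product is \<open>f_c f_4c / f_2c\<close>, where \<open>f_2c = f_c^2\<close> and
  \<open>f_4c = f_c^4\<close>.\<close>

lemma theta_4:
  assumes "c > 0"
  shows "theta (4 * int c) (int c) = euler_prod c ^ 3"
proof -
  let ?A = "{n. 0 < n \<and> n mod (4 * c) \<in> {0, c, 4 * c - c}}"
  have iff: "n mod (4 * c) \<in> {0, c, 4 * c - c} \<longleftrightarrow> c dvd n \<and> (2 * c dvd n \<longrightarrow> 4 * c dvd n)" for n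
  proof (cases "c dvd n")
    case True
    then obtain m where m: "n = c * m" ..
    have "m mod 4 = 0 \<or> m mod 4 = 1 \<or> m mod 4 = 2 \<or> m mod 4 = 3" by auto
    moreover have "n mod (4 * c) = c * (m mod 4)" unfolding m by (simp add: mult.commute mod_mult_mult2)
    moreover have "2 * c dvd n \<longleftrightarrow> 2 dvd m" "4 * c dvd n \<longleftrightarrow> 4 dvd m"
      unfolding m using assms by (simp_all add: mult.commute)
    moreover have "2 dvd m \<longleftrightarrow> m mod 4 = 0 \<or> m mod 4 = 2" "4 dvd m \<longleftrightarrow> m mod 4 = 0" by presburger+
    ultimately show ?thesis using assms True by (elim disjE) simp_all
  next
    case False
    have no: "n mod (4 * c) \<notin> {0, c, 4 * c - c}"
    proof
      assume "n mod (4 * c) \<in> {0, c, 4 * c - c}"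
      then have "c dvd n mod (4 * c)" by auto
      then show False using False by (simp add: dvd_mod_iff)
    qed
    show ?thesis by (simp only: no False simp_thms)
  qed
  have "euler_prod c * euler_prod (4 * c) = theta (int (4 * c)) (int c) * euler_prod (2 * c)"
  proof -
    define B where "B = {n. 0 < n \<and> c dvd n \<and> \<not> 2 * c dvd n}"
    have "{n. 0 < n \<and> c dvd n} = B \<union> {n. 0 < n \<and> 2 * c dvd n}"
      unfolding B_def by (auto dest: dvd_mult_right)
    then have "euler_prod c = fps_prod_set B * euler_prod (2 * c)"
      unfolding euler_prod_def B_def by (auto intro: fps_prod_set_union)
    moreover have dvd42: "4 * c dvd n \<Longrightarrow> 2 * c dvd n" for n
      by (rule dvd_trans[of _ "4 * c"]) auto
    then have "?A = B \<union> {n. 0 < n \<and> 4 * c dvd n}"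
      unfolding B_def iff by (auto dest: dvd_mult_right)
    then have "fps_prod_set ?A = fps_prod_set B * euler_prod (4 * c)"
      unfolding euler_prod_def B_def
      by (simp only:) (rule fps_prod_set_union, use dvd42 in blast)
    moreover have "fps_prod_set ?A = theta (int (4 * c)) (int c)"
      by (rule triple_product) (use assms in auto)
    ultimately show ?thesis by (simp add: mult_ac)
  qed
  then have "euler_prod c ^ 2 * (euler_prod c ^ 3) = euler_prod c ^ 2 * theta (4 * int c) (int c)"
    using euler_prod_double[OF assms] euler_prod_double[of "2 * c"] assms
    by (simp add: mult_ac power2_eq_square power3_eq_cube)
  then show ?thesis using euler_prod_nonzero[of c] by (metis mult_left_cancel power_not_zero)
qed

text \<open>The exponents are the multiples of 6c and the products of c with numbers prime to 6.
  This gives \<open>f_c f_6c^2 / (f_2c f_3c)\<close>, which is \<open>f_3c^3 / f_c\<close> by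
  \<open>f_2c = f_c^2\<close> and \<open>f_6c = f_3c^2\<close>. The sets \<open>B\<close> and
  \<open>B2\<close> express it without division.\<close>

lemma theta_6:
  assumes "c > 0"
  shows "euler_prod c * theta (6 * int c) (int c) = euler_prod (3 * c) ^ 3"
proof -
  let ?A = "{n. 0 < n \<and> n mod (6 * c) \<in> {0, c, 6 * c - c}}"
  define B where "B = {n. 0 < n \<and> c dvd n \<and> \<not> 2 * c dvd n \<and> \<not> 3 * c dvd n}"
  define B2 where "B2 = {n. 0 < n \<and> 2 * c dvd n \<and> \<not> 6 * c dvd n}"
  have cdvd: "d * c dvd n \<Longrightarrow> c dvd n" for d n by (auto dest: dvd_mult_right)
  have dvd6: "6 * c dvd n \<longleftrightarrow> 2 * c dvd n \<and> 3 * c dvd n" for n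
  proof (cases "c dvd n")
    case True
    then obtain m where m: "n = c * m" ..
    have "2 * c dvd n \<longleftrightarrow> 2 dvd m" "3 * c dvd n \<longleftrightarrow> 3 dvd m" "6 * c dvd n \<longleftrightarrow> 6 dvd m"
      unfolding m using assms by (simp_all add: mult.commute)
    moreover have "6 dvd m \<longleftrightarrow> 2 dvd m \<and> 3 dvd m" by presburger
    ultimately show ?thesis by simp
  qed (auto dest: cdvd)
  have iff: "n mod (6 * c) \<in> {0, c, 6 * c - c} \<longleftrightarrow>
      6 * c dvd n \<or> (c dvd n \<and> \<not> 2 * c dvd n \<and> \<not> 3 * c dvd n)" for n
  proof (cases "c dvd n")
    case True
    then obtain m where m: "n = c * m" ..
    have "m mod 6 = 0 \<or> m mod 6 = 1 \<or> m mod 6 = 2 \<or> m mod 6 = 3 \<or> m mod 6 = 4 \<or> m mod 6 = 5" by auto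
    moreover have "n mod (6 * c) = c * (m mod 6)" unfolding m by (simp add: mult.commute mod_mult_mult2)
    moreover have "2 * c dvd n \<longleftrightarrow> 2 dvd m" "3 * c dvd n \<longleftrightarrow> 3 dvd m" "6 * c dvd n \<longleftrightarrow> 6 dvd m"
      unfolding m using assms by (simp_all add: mult.commute)
    moreover have "2 dvd m \<longleftrightarrow> m mod 6 = 0 \<or> m mod 6 = 2 \<or> m mod 6 = 4"
        "3 dvd m \<longleftrightarrow> m mod 6 = 0 \<or> m mod 6 = 3" "6 dvd m \<longleftrightarrow> m mod 6 = 0"
      by presburger+
    ultimately show ?thesis using assms True by (elim disjE) simp_all
  next
    case False
    have no: "n mod (6 * c) \<notin> {0, c, 6 * c - c}"
    proof
      assume "n mod (6 * c) \<in> {0, c, 6 * c - c}"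
      then have "c dvd n mod (6 * c)" by auto
      then show False using False by (simp add: dvd_mod_iff)
    qed
    show ?thesis by (simp only: no False simp_thms) (use False cdvd in blast)
  qed
  have "fps_prod_set (B \<union> {n. 0 < n \<and> 6 * c dvd n}) = fps_prod_set B * euler_prod (6 * c)"
    unfolding euler_prod_def by (rule fps_prod_set_union) (auto simp: B_def dvd6)
  moreover have "B \<union> {n. 0 < n \<and> 6 * c dvd n} = ?A" unfolding iff B_def by auto
  moreover have "fps_prod_set ?A = theta (int (6 * c)) (int c)"
    by (rule triple_product) (use assms in auto)
  ultimately have A: "theta (6 * int c) (int c) = fps_prod_set B * euler_prod (6 * c)" by simp
  have "fps_prod_set (B2 \<union> {n. 0 < n \<and> 6 * c dvd n}) = fps_prod_set B2 * euler_prod (6 * c)"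
    unfolding euler_prod_def by (rule fps_prod_set_union) (auto simp: B2_def)
  moreover have "B2 \<union> {n. 0 < n \<and> 6 * c dvd n} = {n. 0 < n \<and> 2 * c dvd n}"
    unfolding B2_def dvd6 by auto
  ultimately have E2: "euler_prod (2 * c) = fps_prod_set B2 * euler_prod (6 * c)"
    by (simp add: euler_prod_def)
  have "fps_prod_set (B \<union> (B2 \<union> {n. 0 < n \<and> 3 * c dvd n})) =
      fps_prod_set B * (fps_prod_set B2 * euler_prod (3 * c))"
    unfolding euler_prod_def
    by (subst fps_prod_set_union, force simp: B_def B2_def)
       (subst fps_prod_set_union, auto simp: B2_def dvd6)
  moreover have "B \<union> (B2 \<union> {n. 0 < n \<and> 3 * c dvd n}) = {n. 0 < n \<and> c dvd n}"
    unfolding B_def B2_def dvd6 by (auto dest: cdvd)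
  ultimately have E1: "euler_prod c = fps_prod_set B * (fps_prod_set B2 * euler_prod (3 * c))"
    by (simp add: euler_prod_def)
  have E6: "euler_prod (6 * c) = euler_prod (3 * c) ^ 2"
    using euler_prod_double[of "3 * c"] assms by simp
  have "euler_prod c * (euler_prod c * theta (6 * int c) (int c)) =
      euler_prod c ^ 2 * fps_prod_set B * euler_prod (6 * c)"
    unfolding A by (simp add: power2_eq_square mult_ac)
  also have "\<dots> = euler_prod (6 * c) * euler_prod (6 * c) * (fps_prod_set B * fps_prod_set B2)"
    using E2 euler_prod_double[OF assms] by (simp add: mult_ac)
  also have "\<dots> = euler_prod (3 * c) ^ 3 * (fps_prod_set B * (fps_prod_set B2 * euler_prod (3 * c)))"
    unfolding E6 by (simp add: power2_eq_square power3_eq_cube mult_ac)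
  also have "\<dots> = euler_prod c * euler_prod (3 * c) ^ 3"
    using E1 by (simp add: mult_ac)
  finally show ?thesis using euler_prod_nonzero[of c] by simp
qed

text \<open>The exponents on the left are the triangular numbers \<open>2j^2 - j\<close>. The
  classes 0 and 2 of \<open>j\<close> modulo 3 become the even and the odd indices of
  \<open>theta 9 3\<close>, while \<open>j = 1 - 3i\<close> gives
  \<open>1 + 9 (2i^2 - i)\<close>.\<close>

lemma theta_dissection: "theta 4 1 = theta 9 3 + fps_X * theta 36 9"
proof (rule fps_ext)
  fix n :: nat
  let ?e = "theta_exponent"
  have e_41: "?e 4 1 j = 2 * j * j - j" for j
    using theta_exponent_double[of 4 1 j] by (simp add: algebra_simps)
  have e_93: "2 * ?e 9 3 j = 9 * j * j - 3 * j" for j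
    using theta_exponent_double[of 9 3 j] by (simp add: algebra_simps)
  have e_369: "?e 36 9 j = 18 * j * j - 9 * j" for j
    using theta_exponent_double[of 36 9 j] by (simp add: algebra_simps)
  have even_odd: "?e 9 3 (2 * i) = ?e 4 1 (3 * i)" "?e 9 3 (- (2 * i + 1)) = ?e 4 1 (3 * i + 2)" for i
    using e_93[of "2 * i"] e_93[of "- (2 * i + 1)"] e_41[of "3 * i"] e_41[of "3 * i + 2"]
    by (simp_all add: algebra_simps)
  have one: "?e 4 1 (3 * i + 1) = ?e 36 9 (- i) + 1" for i
    using e_41[of "3 * i + 1"] e_369[of "- i"] by (simp add: algebra_simps)
  let ?S = "{j. ?e 4 1 j = int n}"
  have fin: "finite ?S" by (rule finite_theta_exponent) auto
  define S0 where "S0 = {j \<in> ?S. j mod 3 \<noteq> 1}"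
  define S1 where "S1 = {j \<in> ?S. j mod 3 = 1}"
  have S: "card ?S = card S0 + card S1"
  proof -
    have "?S = S0 \<union> S1" "S0 \<inter> S1 = {}" "finite S0" "finite S1"
      using fin by (auto simp: S0_def S1_def)
    then show ?thesis by (simp add: card_Un_disjoint)
  qed
  have "card S0 = card {j. ?e 9 3 j = int n}"
  proof -
    define h where "h j = (if j mod 3 = 0 then 2 * (j div 3) else - (2 * (j div 3) + 1))" for j :: int
    \<comment> \<open>An odd \<open>k = -(2i+1)\<close> has \<open>k div 2 = -i - 1\<close>, so
      \<open>i = -(k div 2) - 1\<close>, and \<open>g k = 3i + 2\<close>.\<close>
    define g where "g k = (if even k then 3 * (k div 2) else 3 * (- (k div 2) - 1) + 2)" for k :: int
    have j_cases: "(\<exists>i. j = 3 * i) \<or> (\<exists>i. j = 3 * i + 2)" if "j mod 3 \<noteq> 1" for j :: int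
      using that by presburger
    have div2: "(- (2 * i) - 1) div 2 = - i - 1" for i :: int by presburger
    have gh: "g (h j) = j" and eh: "?e 9 3 (h j) = ?e 4 1 j" if "j mod 3 \<noteq> 1" for j
      using j_cases[OF that] even_odd by (auto simp: g_def h_def div2)
    have g: "g k mod 3 \<noteq> 1" "h (g k) = k" for k
    proof -
      have "(- 1 - 3 * b) mod 3 = 2" "(- 1 - 3 * b) div 3 = - b - 1" "\<not> 3 dvd - 1 - 3 * b" for b :: int
        by presburger+
      then show "g k mod 3 \<noteq> 1" "h (g k) = k" by (auto simp: g_def h_def elim!: evenE oddE)
    qed
    have eg: "?e 4 1 (g k) = ?e 9 3 k" for k
      using eh[OF g(1)[of k]] by (simp add: g(2))
    have "bij_betw h S0 {j. ?e 9 3 j = int n}"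
      by (rule bij_betw_byWitness[where f' = g])
         (auto simp: S0_def gh g eh eg)
    then show ?thesis by (rule bij_betw_same_card)
  qed
  moreover have "card S1 = card {j. ?e 36 9 j + 1 = int n}"
  proof -
    have "S1 = (\<lambda>i. 3 * - i + 1) ` {i. ?e 36 9 i + 1 = int n}"
    proof (intro equalityI subsetI)
      fix j assume j: "j \<in> S1"
      then have "j = 3 * - (- (j div 3)) + 1" unfolding S1_def by simp presburger
      moreover have "?e 36 9 (- (j div 3)) + 1 = int n"
        using one[of "j div 3"] j calculation by (simp add: S1_def)
      ultimately show "j \<in> (\<lambda>i. 3 * - i + 1) ` {i. ?e 36 9 i + 1 = int n}" by blast
    next
      fix j assume "j \<in> (\<lambda>i. 3 * - i + 1) ` {i. ?e 36 9 i + 1 = int n}"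
      then obtain i where i: "j = 3 * - i + 1" "?e 36 9 i + 1 = int n" by blast
      have "j mod 3 = 1" using i(1) by presburger
      then show "j \<in> S1" using one[of "- i"] i by (simp add: S1_def)
    qed
    then show ?thesis by (simp add: card_image inj_on_def)
  qed
  ultimately have card: "card ?S = card {j. ?e 9 3 j = int n} + card {j. ?e 36 9 j + 1 = int n}"
    using S by simp
  have ge: "0 \<le> ?e 36 9 j" for j
    using theta_exponent_ge_abs[of 9 36 j] by simp
  have "(fps_X * theta 36 9) $ n = of_nat (card {j. ?e 36 9 j + 1 = int n})"
  proof (cases n)
    case 0
    then have "{j. ?e 36 9 j + 1 = int n} = {}" using ge by (smt (verit) Collect_empty_eq of_nat_0)
    then show ?thesis using 0 by simp
  next
    case (Suc m)
    then show ?thesis by (simp add: theta_def)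
  qed
  then show "theta 4 1 $ n = (theta 9 3 + fps_X * theta 36 9) $ n"
    using card by (simp add: theta_def)
qed

section \<open>Partitions with parts in a given set\<close>

definition partitions_into :: "nat set \<Rightarrow> nat \<Rightarrow> nat multiset set" where
  "partitions_into A n = {P. sum_mset P = n \<and> set_mset P \<subseteq> A}"

definition partitions_fps :: "nat set \<Rightarrow> bit fps" where
  "partitions_fps A = Abs_fps (\<lambda>n. of_nat (card (partitions_into A n)))"

lemma mem_le_sum_mset: "k \<in># P \<Longrightarrow> k \<le> sum_mset P" for P :: "nat multiset"
  by (auto dest!: multi_member_split)

lemma finite_partitions_into:
  assumes "0 \<notin> A"
  shows "finite (partitions_into A n)"
proof (rule finite_subset)
  \<comment> \<open>Since 0 divides only 0, the case \<open>t = 0\<close> of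
    \<open>regular_partitions\<close> consists of all partitions, known to be finitely many.\<close>
  show "partitions_into A n \<subseteq> regular_partitions 0 n"
  proof
    fix P assume P: "P \<in> partitions_into A n"
    then have sub: "set_mset P \<subseteq> A" and sum: "sum_mset P = n"
      by (simp_all add: partitions_into_def)
    have "0 < k" if "k \<in># P" for k
      using that assms sub by (metis gr0I subsetD)
    then show "P \<in> regular_partitions 0 n"
      using sum by (simp add: regular_partitions_def)
  qed
qed (rule finite_regular_partitions)

lemma partitions_into_restrict: "n \<le> N \<Longrightarrow> partitions_into (A \<inter> {..N}) n = partitions_into A n"
  unfolding partitions_into_def by (intro Collect_cong) (meson Int_iff atMost_iff mem_le_sum_mset order_trans subset_iff)

lemma partitions_into_insert:
  assumes "a \<notin> A"
  shows "partitions_into (insert a A) n = partitions_into A n \<union>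
    (if a \<le> n then add_mset a ` partitions_into (insert a A) (n - a) else {})"
proof (intro equalityI subsetI)
  fix P assume P: "P \<in> partitions_into (insert a A) n"
  show "P \<in> partitions_into A n \<union>
    (if a \<le> n then add_mset a ` partitions_into (insert a A) (n - a) else {})"
  proof (cases "a \<in># P")
    case True
    then obtain Q where "P = add_mset a Q" by (auto dest: multi_member_split)
    then show ?thesis using P by (auto simp: partitions_into_def)
  qed (use P in \<open>auto simp: partitions_into_def\<close>)
qed (use assms in \<open>auto simp: partitions_into_def split: if_splits\<close>)

text \<open>A partition either avoids \<open>a\<close> or arises from one of \<open>n - a\<close> by
  adding one copy of \<open>a\<close>. This recursion is multiplication by \<open>1 - q^a\<close>,
  and modulo 2 the sign is immaterial.\<close>

lemma partitions_fps_insert: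
  assumes "a \<notin> A" "a > 0" "0 \<notin> A"
  shows "partitions_fps (insert a A) * (1 + fps_X ^ a) = partitions_fps A"
proof (rule fps_ext)
  fix n
  let ?p = "\<lambda>A n. card (partitions_into A n)"
  have "?p (insert a A) n = ?p A n + (if a \<le> n then ?p (insert a A) (n - a) else 0)"
  proof -
    define B where
      "B = (if a \<le> n then add_mset a ` partitions_into (insert a A) (n - a) else {})"
    have "partitions_into (insert a A) n = partitions_into A n \<union> B"
      unfolding B_def by (rule partitions_into_insert[OF assms(1)])
    moreover have "partitions_into A n \<inter> B = {}"
    proof -
      have "a \<in># P" if "P \<in> B" for P using that by (auto simp: B_def split: if_splits)
      moreover have "a \<notin># P" if "P \<in> partitions_into A n" for P
        using that assms(1) by (auto simp: partitions_into_def)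
      ultimately show ?thesis by blast
    qed
    moreover have "finite (partitions_into A n)" "finite B"
      using assms by (auto simp: finite_partitions_into B_def)
    moreover have "card B = (if a \<le> n then ?p (insert a A) (n - a) else 0)"
      by (simp add: B_def card_image inj_on_def)
    ultimately show ?thesis by (simp add: card_Un_disjoint)
  qed
  then have "(of_nat (?p (insert a A) n) :: bit) =
      of_nat (?p A n) + (if a \<le> n then of_nat (?p (insert a A) (n - a)) else 0)"
    by simp
  moreover have "x + y + y = x" for x y :: bit by (cases y) auto
  ultimately show "(partitions_fps (insert a A) * (1 + fps_X ^ a)) $ n = partitions_fps A $ n"
    by (simp add: partitions_fps_def distrib_left fps_X_power_mult_right_nth)
qed

lemma partitions_fps_finite:
  assumes "finite A" "0 \<notin> A"
  shows "partitions_fps A * fps_prod_finite A = 1"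
  using assms
proof (induction A)
  case empty
  have "partitions_into {} n = (if n = 0 then {{#}} else {})" for n
    by (auto simp: partitions_into_def)
  then show ?case by (auto simp: partitions_fps_def fps_prod_finite_def fps_eq_iff)
next
  case (insert a A)
  then have "partitions_fps (insert a A) * (1 + fps_X ^ a) * fps_prod_finite A = 1"
    using partitions_fps_insert[of a A] by auto
  then show ?case using insert by (simp add: fps_prod_finite_def mult.assoc)
qed

theorem partitions_fps_mult_prod:
  assumes "0 \<notin> A"
  shows "partitions_fps A * fps_prod_set A = 1"
proof (rule fps_eqI_trunc_eq)
  fix N
  have "trunc_eq N (partitions_fps A) (partitions_fps (A \<inter> {..N}))"
    by (simp add: trunc_eq_def partitions_fps_def partitions_into_restrict)
  moreover have "trunc_eq N (fps_prod_set A) (fps_prod_finite (A \<inter> {..N}))"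
    by (rule trunc_eq_fps_prod_set) auto
  ultimately have "trunc_eq N (partitions_fps A * fps_prod_set A)
      (partitions_fps (A \<inter> {..N}) * fps_prod_finite (A \<inter> {..N}))"
    by (rule trunc_eq_mult)
  then show "trunc_eq N (partitions_fps A * fps_prod_set A) 1"
    using assms by (simp add: partitions_fps_finite)
qed

lemma partitions_fps_regular: 
  "partitions_fps {k. 0 < k \<and> \<not> t dvd k} = Abs_fps (\<lambda>n. of_nat (b\<^bsub>t\<^esub> n))"
proof -
  have "partitions_into {k. 0 < k \<and> \<not> t dvd k} n = regular_partitions t n" for n
    by (auto simp: partitions_into_def regular_partitions_def)
  then show ?thesis by (simp add: partitions_fps_def num_regular_partitions_def)
qed

lemma regular_partitions_fps_mult:
  "Abs_fps (\<lambda>n. of_nat (b\<^bsub>t\<^esub> n)) * euler_prod 1 = euler_prod t"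
proof -
  let ?A = "{k. 0 < k \<and> \<not> t dvd k}"
  have "fps_prod_set (?A \<union> {k. 0 < k \<and> t dvd k}) = fps_prod_set ?A * euler_prod t"
    unfolding euler_prod_def by (rule fps_prod_set_union) auto
  moreover have "?A \<union> {k. 0 < k \<and> t dvd k} = {k. 0 < k \<and> 1 dvd k}" by auto
  ultimately have "euler_prod 1 = fps_prod_set ?A * euler_prod t"
    by (simp add: euler_prod_def)
  then have "partitions_fps ?A * euler_prod 1 = partitions_fps ?A * fps_prod_set ?A * euler_prod t"
    by (simp only: mult.assoc)
  also have "\<dots> = euler_prod t"
    by (subst partitions_fps_mult_prod) auto
  finally show ?thesis by (simp only: partitions_fps_regular)
qed

section \<open>The even part\<close>

definition even_part :: "'a::zero fps \<Rightarrow> 'a fps" where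
  "even_part F = Abs_fps (\<lambda>n. F $ (2 * n))"

text \<open>The terms at \<open>i\<close> and \<open>n - i\<close> cancel in pairs, leaving only
  \<open>i = n / 2\<close>; squaring fixes both elements of the field.\<close>

lemma bit_fps_square_nth:
  fixes F :: "bit fps"
  shows "(F ^ 2) $ n = (if even n then F $ (n div 2) else 0)"
proof -
  define f where "f i = F $ i * F $ (n - i)" for i
  have refl: "sum f {i\<in>{..n}. n < 2 * i} = sum f {i\<in>{..n}. 2 * i < n}"
    by (rule sum.reindex_bij_witness[of _ "\<lambda>i. n - i" "\<lambda>i. n - i"])
       (auto simp: f_def mult.commute)
  have "(F ^ 2) $ n = sum f {..n}"
    by (simp add: f_def power2_eq_square fps_mult_nth atLeast0AtMost)
  also have "{..n} = {i\<in>{..n}. 2 * i < n} \<union> {i\<in>{..n}. n < 2 * i} \<union> {i\<in>{..n}. 2 * i = n}" by auto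
  also have "sum f \<dots> = sum f {i\<in>{..n}. 2 * i < n} + sum f {i\<in>{..n}. n < 2 * i} +
      sum f {i\<in>{..n}. 2 * i = n}"
    by (subst sum.union_disjoint; (subst sum.union_disjoint)?) auto
  also have "\<dots> = sum f {i\<in>{..n}. 2 * i = n}"
    unfolding refl by (cases "sum f {i\<in>{..n}. 2 * i < n}") auto
  also have "{i\<in>{..n}. 2 * i = n} = (if even n then {n div 2} else {})" by auto
  also have "sum f \<dots> = (if even n then F $ (n div 2) else 0)"
    by (cases "F $ (n div 2)") (auto simp: f_def elim!: evenE)
  finally show ?thesis .
qed

text \<open>\<open>F ^ 2\<close> has only even exponents, so it pairs with the even exponents of
  \<open>G\<close> alone, and halving turns it back into \<open>F\<close>.\<close>

lemma even_part_square_mult: "even_part (F ^ 2 * G) = F * even_part G" for F G :: "bit fps"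
proof (rule fps_ext)
  fix n
  have "even_part (F ^ 2 * G) $ n = (\<Sum>i\<in>{0..2*n}. (F ^ 2) $ i * G $ (2 * n - i))"
    by (simp add: even_part_def fps_mult_nth)
  also have "\<dots> = (\<Sum>i\<in>(\<lambda>i. 2 * i) ` {0..n}. (F ^ 2) $ i * G $ (2 * n - i))"
    by (rule sum.mono_neutral_right) (auto simp: bit_fps_square_nth elim!: evenE)
  also have "\<dots> = (\<Sum>i\<in>{0..n}. F $ i * G $ (2 * (n - i)))"
    by (subst sum.reindex) (auto simp: inj_on_def bit_fps_square_nth right_diff_distrib')
  finally show "even_part (F ^ 2 * G) $ n = (F * even_part G) $ n"
    by (simp add: even_part_def fps_mult_nth)
qed

section \<open>The 3-regular partitions of even numbers\<close>

text \<open>The series \<open>B\<close>: by \<open>theta_exponent_18_3\<close> the terms of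
  \<open>fps_X * theta 18 3\<close> are \<open>q^((3j-1)^2)\<close>, and \<open>3j - 1\<close> meets
  each pair \<open>m\<close>, \<open>-m\<close> with \<open>m\<close> prime to 3 exactly
  once.\<close>

definition square_series :: "bit fps" where
  "square_series = 1 + fps_X * theta 18 3"

lemma theta_exponent_18_3: "theta_exponent 18 3 j + 1 = (3 * j - 1)\<^sup>2"
  using theta_exponent_double[of 18 3 j] by (simp add: algebra_simps power2_eq_square)

lemma theta_exponent_3_1: "24 * theta_exponent 3 1 j + 1 = (6 * j - 1)\<^sup>2"
  using theta_exponent_double[of 3 1 j] by (simp add: algebra_simps power2_eq_square)

text \<open>For \<open>m > 2\<close> the class of -1 modulo \<open>m\<close> never contains both a
  number and its negative, so the theta coefficients concerned are 0 or 1 even before reduction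
  modulo 2.\<close>

lemma card_square_root_class:
  fixes m :: int
  assumes "m > 2"
  shows "card {j. (m * j - 1)\<^sup>2 = n} = of_bool (\<exists>j. (m * j - 1)\<^sup>2 = n)"
proof (cases "\<exists>j. (m * j - 1)\<^sup>2 = n")
  case True
  then obtain j where j: "(m * j - 1)\<^sup>2 = n" ..
  have "i = j" if "(m * i - 1)\<^sup>2 = n" for i
  proof -
    have "(m * i - 1)\<^sup>2 = (m * j - 1)\<^sup>2" using that j by simp
    then consider "m * i - 1 = m * j - 1" | "m * i - 1 = - (m * j - 1)"
      unfolding power2_eq_iff by blast
    then show ?thesis
    proof cases
      case 2
      then have "m * (i + j) = 2" by (simp add: algebra_simps)
      then have "m dvd 2" by (metis dvd_triv_left)
      then show ?thesis using assms zdvd_imp_le[of m 2] by simp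
    qed (use assms in simp)
  qed
  then have "{j. (m * j - 1)\<^sup>2 = n} = {j}" using j by blast
  then show ?thesis using True by simp
qed auto

lemma square_root_class:
  fixes m x :: nat
  assumes "x mod m = 1 \<or> Suc x mod m = 0"
  shows "\<exists>j. (int m * j - 1)\<^sup>2 = (int x)\<^sup>2"
  using assms
proof
  assume "x mod m = 1"
  then have "x = m * (x div m) + 1" by (metis mult_div_mod_eq)
  then have "int x = int m * int (x div m) + 1" by (metis of_nat_1 of_nat_add of_nat_mult)
  then have "int m * (- int (x div m)) - 1 = - int x" by simp
  then show ?thesis by (metis power2_minus)
next
  assume "Suc x mod m = 0"
  then obtain k where "Suc x = m * k" by auto
  then have "int m * int k - 1 = int x" by (metis diff_add_cancel add_diff_cancel_right' of_nat_Suc of_nat_mult add.commute)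
  then show ?thesis by metis
qed

lemma square_not_dvd_3_iff:
  "(\<exists>j::int. (3 * j - 1)\<^sup>2 = int n) \<longleftrightarrow> (\<exists>m::nat. \<not> 3 dvd m \<and> n = m\<^sup>2)"
proof
  assume "\<exists>j::int. (3 * j - 1)\<^sup>2 = int n"
  then obtain j :: int where j: "(3 * j - 1)\<^sup>2 = int n" ..
  have "\<not> 3 dvd 3 * j - 1" by presburger
  then have "\<not> 3 dvd nat \<bar>3 * j - 1\<bar>" by (simp add: dvd_nat_abs_iff)
  moreover have "n = (nat \<bar>3 * j - 1\<bar>)\<^sup>2" using j by (simp flip: of_nat_eq_iff[where 'a = int])
  ultimately show "\<exists>m::nat. \<not> 3 dvd m \<and> n = m\<^sup>2" by blast
next
  assume "\<exists>m::nat. \<not> 3 dvd m \<and> n = m\<^sup>2"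
  then obtain m :: nat where m: "\<not> 3 dvd m" "n = m\<^sup>2" by blast
  have "m mod 3 = 1 \<or> Suc m mod 3 = 0" using m(1) by presburger
  then show "\<exists>j::int. (3 * j - 1)\<^sup>2 = int n" using square_root_class[of m 3] m by simp
qed

lemma square_series_nth:
  "square_series $ n = of_bool (n = 0 \<or> (\<exists>m::nat. \<not> 3 dvd m \<and> n = m\<^sup>2))"
proof (cases n)
  case 0 then show ?thesis by (simp add: square_series_def)
next
  case (Suc k)
  have "{j. theta_exponent 18 3 j = int k} = {j. (3 * j - 1)\<^sup>2 = int n}"
    by (auto simp: Suc theta_exponent_18_3[symmetric])
  then have "square_series $ n = of_nat (card {j::int. (3 * j - 1)\<^sup>2 = int n})"
    by (simp add: square_series_def theta_def Suc)
  then show ?thesis using Suc card_square_root_class[of 3 "int n"] square_not_dvd_3_iff[of n]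
    by simp
qed

text \<open>\<open>24n + 1 = x^2\<close> forces \<open>x\<close> to be 1 or 5 modulo 6, so up to
  sign \<open>x\<close> lies in the class \<open>6j - 1\<close> of
  \<open>theta_exponent_3_1\<close>.\<close>

lemma euler_prod_1_nth: "euler_prod 1 $ n = of_bool (\<exists>x::nat. 24 * n + 1 = x\<^sup>2)"
proof -
  have "{j. theta_exponent 3 1 j = int n} = {j. (6 * j - 1)\<^sup>2 = int (24 * n + 1)}"
    by (auto simp: theta_exponent_3_1[symmetric])
  then have "euler_prod 1 $ n = of_nat (card {j. (6 * j - 1)\<^sup>2 = int (24 * n + 1)})"
    using theta_3[of 1] by (simp add: theta_def flip: theta_3)
  also have "\<dots> = of_bool (\<exists>j. (6 * j - 1)\<^sup>2 = int (24 * n + 1))"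
    using card_square_root_class[of 6 "int (24 * n + 1)"] by simp
  also have "(\<exists>j. (6 * j - 1)\<^sup>2 = int (24 * n + 1)) \<longleftrightarrow> (\<exists>x::nat. 24 * n + 1 = x\<^sup>2)"
  proof
    assume "\<exists>j. (6 * j - 1)\<^sup>2 = int (24 * n + 1)"
    then obtain j :: int where "(6 * j - 1)\<^sup>2 = int (24 * n + 1)" ..
    then have "24 * n + 1 = (nat \<bar>6 * j - 1\<bar>)\<^sup>2" by (simp flip: of_nat_eq_iff[where 'a = int])
    then show "\<exists>x::nat. 24 * n + 1 = x\<^sup>2" ..
  next
    assume "\<exists>x::nat. 24 * n + 1 = x\<^sup>2"
    then obtain x :: nat where x: "24 * n + 1 = x\<^sup>2" ..
    have "(x mod 6) * (x mod 6) mod 6 = (24 * n + 1) mod 6"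
      unfolding x by (simp add: power2_eq_square mod_mult_eq)
    also have "\<dots> = 1" by presburger
    finally have "(x mod 6) * (x mod 6) mod 6 = 1" .
    moreover have "x mod 6 = 0 \<or> x mod 6 = 1 \<or> x mod 6 = 2 \<or> x mod 6 = 3 \<or> x mod 6 = 4 \<or> x mod 6 = 5"
      by auto
    ultimately have "x mod 6 = 1 \<or> x mod 6 = 5" by auto
    then have "x mod 6 = 1 \<or> Suc x mod 6 = 0" by presburger
    then have "\<exists>j. (6 * j - 1)\<^sup>2 = (int x)\<^sup>2" using square_root_class[of x 6] by simp
    moreover have "(int x)\<^sup>2 = int (24 * n + 1)" unfolding x by simp
    ultimately show "\<exists>j. (6 * j - 1)\<^sup>2 = int (24 * n + 1)" by simp
  qed
  finally show ?thesis .
qed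

text \<open>An even square is \<open>m^2\<close> with \<open>m = 2k\<close>, so
  \<open>2n = m^2\<close> means \<open>n = 2k^2\<close>; the factor 2 does not affect divisibility
  by 3. By Frobenius the exponents \<open>2k^2\<close> are those of the squared series.\<close>

lemma even_part_square_series: "even_part square_series = square_series ^ 2"
proof (rule fps_ext)
  fix n
  have "(\<exists>m::nat. \<not> 3 dvd m \<and> 2 * n = m\<^sup>2) \<longleftrightarrow> even n \<and> (\<exists>m::nat. \<not> 3 dvd m \<and> n div 2 = m\<^sup>2)"
  proof
    assume "\<exists>m::nat. \<not> 3 dvd m \<and> 2 * n = m\<^sup>2"
    then obtain m :: nat where m: "\<not> 3 dvd m" "2 * n = m\<^sup>2" by blast
    then have "even m" by (metis dvd_triv_left even_power pos2)
    then obtain k where k: "m = 2 * k" ..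
    then have "n = 2 * k\<^sup>2" using m by (simp add: power2_eq_square)
    moreover have "\<not> 3 dvd k" using m k by auto
    ultimately show "even n \<and> (\<exists>m::nat. \<not> 3 dvd m \<and> n div 2 = m\<^sup>2)" by auto
  next
    assume "even n \<and> (\<exists>m::nat. \<not> 3 dvd m \<and> n div 2 = m\<^sup>2)"
    then obtain k :: nat where k: "\<not> 3 dvd k" "n = 2 * k\<^sup>2" by (auto elim!: evenE)
    moreover have "\<not> 3 dvd 2 * k" using k by presburger
    ultimately show "\<exists>m::nat. \<not> 3 dvd m \<and> 2 * n = m\<^sup>2"
      by (intro exI[of _ "2 * k"]) (simp add: power2_eq_square)
  qed
  then show "even_part square_series $ n = (square_series ^ 2) $ n"
    by (auto simp: even_part_def bit_fps_square_nth square_series_nth elim!: evenE)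
qed

theorem even_part_regular_3:
  "Abs_fps (\<lambda>n. of_nat (b\<^bsub>3\<^esub> (2 * n))) = euler_prod 1 * square_series"
proof -
  define f1 where "f1 = euler_prod 1"
  define f3 where "f3 = euler_prod 3"
  define H where "H = Abs_fps (\<lambda>n. of_nat (b\<^bsub>3\<^esub> n) :: bit)"
  have H: "H * f1 = f3"
    using regular_partitions_fps_mult[of 3] by (simp only: H_def f1_def f3_def)
  have "f1 ^ 3 = theta 4 1" using theta_4[of 1] by (simp add: f1_def)
  also have "\<dots> = f3 + fps_X * euler_prod 9 ^ 3"
    using theta_dissection theta_3[of 3] theta_4[of 9] by (simp add: f3_def)
  also have "euler_prod 9 ^ 3 = f3 * theta 18 3"
    using theta_6[of 3] by (simp add: f3_def)
  finally have f1: "f1 ^ 3 = f3 * square_series"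
    by (simp add: square_series_def algebra_simps)
  have nz: "f1 \<noteq> 0" "f3 \<noteq> 0"
    by (simp_all add: f1_def f3_def euler_prod_nonzero)
  have "f3 * (H * square_series) = H * f1 ^ 3" unfolding f1 by (simp only: mult_ac)
  also have "\<dots> = (H * f1) * f1 ^ 2" by (simp add: power2_eq_square power3_eq_cube mult_ac)
  finally have "f3 * (H * square_series) = f3 * f1 ^ 2" unfolding H .
  then have "H * square_series = f1 ^ 2" using nz by simp
  \<comment> \<open>A further factor \<open>square_series\<close> puts a square on both sides.
    Taking even parts replaces each square by its root, and the even part of
    \<open>square_series\<close> supplies the factor that is then cancelled.\<close>
  then have "square_series ^ 2 * H = f1 ^ 2 * square_series"
    by (simp add: power2_eq_square mult_ac)
  then have "square_series * even_part H = f1 * square_series ^ 2"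
    by (metis even_part_square_mult even_part_square_series)
  moreover have "square_series \<noteq> 0"
  proof
    assume "square_series = 0"
    then show False using square_series_nth[of 0] by simp
  qed
  ultimately have "even_part H = f1 * square_series"
    by (simp add: power2_eq_square mult.left_commute)
  then show ?thesis by (simp add: even_part_def H_def f1_def)
qed

section \<open>The quadratic character of discriminant -24\<close>

text \<open>The Kronecker symbol of -24, which at a prime p > 3 is the Legendre symbol of -6. Given
  as a table, so that multiplicativity is a finite check.\<close>

definition chi :: "nat \<Rightarrow> int" where
  "chi n = (if n mod 24 \<in> {1, 5, 7, 11} then 1 else if n mod 24 \<in> {13, 17, 19, 23} then -1 else 0)"

lemma chi_mod [simp]: "chi (n mod 24) = chi n"
  by (simp add: chi_def)

lemma chi_values: "chi n = 1 \<or> chi n = -1 \<or> chi n = 0"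
  by (simp add: chi_def)

text \<open>A literal set, so that \<open>ball_simps\<close> splits a claim about residues into 24
  instances to be evaluated.\<close>

abbreviation residues_24 :: "nat set" where
  "residues_24 \<equiv> {0, 1, 2, 3, 4, 5, 6, 7, 8, 9, 10, 11, 12, 13, 14, 15, 16, 17, 18, 19, 20, 21, 22, 23}"

lemma mod_24_in_residues: "n mod 24 \<in> residues_24"
proof -
  have "m \<in> residues_24" if "m < 24" for m
    using that by (simp only: insert_iff empty_iff) presburger
  moreover have "n mod 24 < 24" by simp
  ultimately show ?thesis by blast
qed

lemma chi_eq_0_iff: "chi n = 0 \<longleftrightarrow> 2 dvd n \<or> 3 dvd n"
proof -
  have *: "\<forall>a\<in>residues_24. chi a = 0 \<longleftrightarrow> 2 dvd a \<or> 3 dvd a"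
    by (simp add: chi_def)
  have "chi (n mod 24) = 0 \<longleftrightarrow> 2 dvd n mod 24 \<or> 3 dvd n mod 24"
    by (rule bspec[OF * mod_24_in_residues])
  then show ?thesis by (simp add: dvd_mod_iff)
qed

lemma chi_nonzeroE:
  assumes "chi a \<noteq> 0"
  obtains r where "r \<in> {1, 5, 7, 11, 13, 17, 19, 23}" "a mod 24 = r"
  using assms by (auto simp: chi_def split: if_splits)

lemma chi_mult: "chi (a * b) = chi a * chi b"
proof (cases "chi a = 0 \<or> chi b = 0")
  case True
  then have "chi (a * b) = 0" by (auto simp: chi_eq_0_iff)
  then show ?thesis using True by auto
next
  case False
  obtain r where r: "r \<in> {1, 5, 7, 11, 13, 17, 19, 23}" "a mod 24 = r"
    by (rule chi_nonzeroE[of a]) (use False in auto)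
  obtain s where s: "s \<in> {1, 5, 7, 11, 13, 17, 19, 23}" "b mod 24 = s"
    by (rule chi_nonzeroE[of b]) (use False in auto)
  have *: "\<forall>r\<in>{1, 5, 7, 11, 13, 17, 19, 23}. \<forall>s\<in>{1, 5, 7, 11, 13, 17, 19, 23}. chi (r * s) = chi r * chi s"
    by (simp only: ball_simps) (simp add: chi_def)
  have "chi (r * s) = chi r * chi s"
    by (rule bspec[OF bspec[OF * r(1)] s(1)])
  moreover have "chi (r * s) = chi (a * b)"
    unfolding r(2)[symmetric] s(2)[symmetric] by (metis chi_mod mod_mult_eq)
  ultimately show ?thesis using r(2) s(2) chi_mod by metis
qed

lemma chi_power: "chi (a ^ k) = chi a ^ k"
proof (induction k)
  case 0 then show ?case by (simp add: chi_def)
qed (simp add: chi_mult)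

lemma chi_eq_1_if_prime_factors:
  assumes "n > 0" "\<And>p. prime p \<Longrightarrow> p dvd n \<Longrightarrow> chi p = 1"
  shows "chi n = 1"
  using assms
proof (induction n rule: less_induct)
  case (less n)
  show ?case
  proof (cases "n = 1")
    case True then show ?thesis by (simp add: chi_def)
  next
    case False
    then obtain p where p: "prime p" "p dvd n" using prime_factor_nat by blast
    then obtain m where m: "n = p * m" by blast
    then have "m < n" "m > 0" using less.prems prime_gt_1_nat[OF p(1)] by auto
    then have "chi m = 1" using less.IH less.prems m by auto
    then show ?thesis using m less.prems p by (simp add: chi_mult)
  qed
qed

lemma chi_eq_1I: "n mod 24 \<in> {1, 5, 7, 11} \<Longrightarrow> chi n = 1"
  by (simp only: chi_def if_True)

lemma quadratic_mod_24: "(c * (x mod 24)\<^sup>2 + d) mod 24 = (c * x\<^sup>2 + d) mod (24::nat)"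
  by (intro mod_add_cong mod_mult_cong refl) (simp_all add: power_mod)

lemma square_mod_24_eq_1:
  fixes x :: nat
  assumes "chi x \<noteq> 0"
  shows "x\<^sup>2 mod 24 = 1"
proof -
  have *: "\<forall>a\<in>residues_24. chi a \<noteq> 0 \<longrightarrow> a\<^sup>2 mod 24 = 1"
    by (simp only: ball_simps) (simp add: chi_def)
  have "chi (x mod 24) \<noteq> 0" using assms by simp
  then have "(x mod 24)\<^sup>2 mod 24 = 1" by (intro mp[OF bspec[OF * mod_24_in_residues[of x]]])
  then show ?thesis by (simp add: power_mod)
qed

text \<open>Removing the common factor of \<open>x\<close> and 6 leaves a value prime to 6 of one of
  \<open>y^2 + 6\<close>, \<open>2y^2 + 3\<close>, \<open>3y^2 + 2\<close>, \<open>6y^2 + 1\<close>,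
  and these are 1, 5, 7 or 11 modulo 24. This is the congruence obstruction that drives the
  descent.\<close>

lemma square_plus_6_factor:
  fixes x :: nat
  obtains d m where "x\<^sup>2 + 6 = d * m" "d dvd 6" "chi m = 1"
proof -
  consider "chi x \<noteq> 0" | "even x" "\<not> 3 dvd x" | "odd x" "3 dvd x" | "6 dvd x"
  proof (cases "even x"; cases "3 dvd x")
    assume "even x" "3 dvd x"
    then have "6 dvd x" by presburger
    then show ?thesis using that(4) by blast
  qed (use chi_eq_0_iff[of x] that in blast)+
  then show thesis
  proof cases
    case 1
    then have "x\<^sup>2 mod 24 = 1" by (rule square_mod_24_eq_1)
    then have "(x\<^sup>2 + 6) mod 24 = 7" using mod_add_left_eq[of "x\<^sup>2" 24 6] by simp
    then have "chi (x\<^sup>2 + 6) = 1" by (intro chi_eq_1I) simp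
    then show thesis by (intro that[of 1 "x\<^sup>2 + 6"]) simp_all
  next
    case 2
    then obtain y where y: "x = 2 * y" by blast
    have *: "\<forall>a\<in>residues_24. \<not> 3 dvd a \<longrightarrow> (2 * a\<^sup>2 + 3) mod 24 \<in> {5, 11}" by (simp only: ball_simps) simp
    have "\<not> 3 dvd y" using 2(2) unfolding y by (metis dvd_mult)
    then have "\<not> 3 dvd y mod 24" by (simp add: dvd_mod_iff)
    then have "(2 * (y mod 24)\<^sup>2 + 3) mod 24 \<in> {5, 11}" by (intro mp[OF bspec[OF * mod_24_in_residues[of y]]])
    then have "(2 * y\<^sup>2 + 3) mod 24 \<in> {5, 11}"
      unfolding quadratic_mod_24 .
    then have "chi (2 * y\<^sup>2 + 3) = 1" using chi_eq_1I by blast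
    then show thesis by (intro that[of 2 "2 * y\<^sup>2 + 3"]) (simp_all add: y power_mult_distrib)
  next
    case 3
    then obtain y where y: "x = 3 * y" by blast
    have *: "\<forall>a\<in>residues_24. odd a \<longrightarrow> (3 * a\<^sup>2 + 2) mod 24 \<in> {5}" by (simp only: ball_simps) simp
    have "odd y" using 3(1) unfolding y by simp
    then have "odd (y mod 24)" by (simp add: dvd_mod_iff)
    then have "(3 * (y mod 24)\<^sup>2 + 2) mod 24 \<in> {5}" by (intro mp[OF bspec[OF * mod_24_in_residues[of y]]])
    then have "(3 * y\<^sup>2 + 2) mod 24 \<in> {5}"
      unfolding quadratic_mod_24 .
    then have "chi (3 * y\<^sup>2 + 2) = 1" using chi_eq_1I by blast
    then show thesis by (intro that[of 3 "3 * y\<^sup>2 + 2"]) (simp_all add: y power_mult_distrib)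
  next
    case 4
    then obtain y where y: "x = 6 * y" by blast
    have *: "\<forall>a\<in>residues_24. (6 * a\<^sup>2 + 1) mod 24 \<in> {1, 7::nat}" by (simp only: ball_simps) simp
    have "(6 * (y mod 24)\<^sup>2 + 1) mod 24 \<in> {1, 7}" by (rule bspec[OF * mod_24_in_residues[of y]])
    then have "(6 * y\<^sup>2 + 1) mod 24 \<in> {1, 7}"
      unfolding quadratic_mod_24 .
    then have "chi (6 * y\<^sup>2 + 1) = 1" using chi_eq_1I by blast
    then show thesis by (intro that[of 6 "6 * y\<^sup>2 + 1"]) (simp_all add: y power_mult_distrib)
  qed
qed

text \<open>Fermat descent: the cofactor of \<open>p\<close> in \<open>x\<^sup>2 + 6\<close> with \<open>x < p\<close> has only smaller prime factors.\<close>

lemma not_dvd_square_plus_6: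
  fixes p x :: nat
  assumes "prime p" "chi p = -1"
  shows "\<not> p dvd x\<^sup>2 + 6"
  using assms
proof (induction p arbitrary: x rule: less_induct)
  case (less p)
  show ?case
  proof
    assume dvd: "p dvd x\<^sup>2 + 6"
    define y where "y = x mod p"
    \<comment> \<open>The smallest residue of value -1 is 13. So \<open>p\<close> is prime to every
      divisor of 6, and \<open>p^2\<close> is large enough for the small \<open>y\<close>
      below.\<close>
    have p: "p > 12" using less.prems(2) by (cases "p \<ge> 13") (auto simp: chi_def split: if_splits)
    have y: "y < p" using p by (simp add: y_def)
    have "(y\<^sup>2 + 6) mod p = (x\<^sup>2 + 6) mod p"
      unfolding y_def by (metis mod_add_left_eq power_mod)
    then have "p dvd y\<^sup>2 + 6" using dvd by (simp add: dvd_eq_mod_eq_0)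
    then obtain k where k: "y\<^sup>2 + 6 = p * k" by blast
    obtain d m where dm: "y\<^sup>2 + 6 = d * m" "d dvd 6" "chi m = 1"
      by (rule square_plus_6_factor)
    have "coprime p d"
    proof -
      have "d \<le> 6" using dm(2) by (simp add: dvd_imp_le)
      moreover have "d > 0" using dm(2) by (cases d) auto
      ultimately have "\<not> p dvd d" using p by (auto dest: dvd_imp_le)
      then show ?thesis using less.prems(1) prime_imp_coprime by blast
    qed
    then have "d dvd k" using k dm(1) by (metis coprime_commute coprime_dvd_mult_right_iff dvd_triv_left)
    then obtain l where l: "k = d * l" by blast
    have "d > 0" using dm(2) by (cases d) auto
    then have m: "m = p * l" using k dm(1) l by simp
    have "m > 0" using dm(3) by (cases m) (auto simp: chi_def)
    then have "l > 0" using m by (cases l) auto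
    have "k < p"
    proof -
      have "(y + 1) * (y + 1) \<le> p * p" using y by (intro mult_mono) auto
      \<comment> \<open>\<open>(y + 1)^2\<close> exceeds \<open>y^2 + 6\<close> as soon as
        \<open>y >= 3\<close>.\<close>
      then have "y\<^sup>2 + 6 < p * p \<or> y < 3" by (simp add: power2_eq_square algebra_simps) linarith
      moreover have "y\<^sup>2 + 6 < p * p" if "y < 3"
      proof -
        have "y * y \<le> 2 * 2" using that by (intro mult_mono) auto
        moreover have "12 * 12 \<le> p * p" using p by (intro mult_mono) auto
        ultimately show ?thesis by (simp add: power2_eq_square)
      qed
      ultimately show ?thesis using k by auto
    qed
    have "chi l = 1"
    proof (rule chi_eq_1_if_prime_factors[OF \<open>l > 0\<close>])
      fix q assume q: "prime q" "q dvd l"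
      have "q \<le> k" using q(2) l \<open>d > 0\<close> \<open>l > 0\<close> by (simp add: dvd_imp_le)
      then have "q < p" using \<open>k < p\<close> by simp
      have "q dvd y\<^sup>2 + 6" using q(2) m dm(1) by simp
      then have "chi q \<noteq> -1" using less.IH[OF \<open>q < p\<close> q(1)] by blast
      moreover have "chi q \<noteq> 0"
      proof
        assume "chi q = 0"
        then have "chi m = 0" using q(2) m by (auto simp: chi_mult)
        then show False using dm(3) by simp
      qed
      ultimately show "chi q = 1" using chi_values by blast
    qed
    then have "chi m = -1" using m less.prems(2) by (simp add: chi_mult)
    then show False using dm(3) by simp
  qed
qed

text \<open>Written as \<open>x^2 + 6 (2y)^2\<close>: if \<open>p\<close> did not divide
  \<open>y\<close>, an inverse \<open>z\<close> of \<open>2y\<close> would give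
  \<open>p dvd (x z)^2 + 6\<close>, against \<open>not_dvd_square_plus_6\<close>.\<close>

lemma dvd_norm_form:
  fixes p x y :: nat
  assumes p: "prime p" "chi p = -1" and dvd: "p dvd x\<^sup>2 + 24 * y\<^sup>2"
  shows "p dvd x \<and> p dvd y"
proof -
  have y: "p dvd y"
  proof (rule ccontr)
    assume "\<not> p dvd y"
    then have "coprime (2 * y) p"
    proof -
      have "\<not> p dvd 2" using p(2) by (auto dest!: dvd_imp_le simp: chi_def le_Suc_eq numeral_2_eq_2)
      then show ?thesis using p(1) \<open>\<not> p dvd y\<close> prime_imp_coprime prime_dvd_mult_iff coprime_commute by metis
    qed
    then obtain z where "[2 * y * z = Suc 0] (mod p)" using cong_solve_coprime_nat by blast
    then have z: "[2 * y * z = 1] (mod p)" by simp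
    have "[(x * z)\<^sup>2 + 6 * (2 * y * z)\<^sup>2 = (x * z)\<^sup>2 + 6 * 1\<^sup>2] (mod p)"
      by (intro cong_add cong_mult cong_pow cong_refl z)
    then have "p dvd (x * z)\<^sup>2 + 6 * (2 * y * z)\<^sup>2 \<longleftrightarrow> p dvd (x * z)\<^sup>2 + 6 * 1\<^sup>2"
      by (rule cong_dvd_iff)
    moreover have "(x * z)\<^sup>2 + 6 * (2 * y * z)\<^sup>2 = (x\<^sup>2 + 24 * y\<^sup>2) * z\<^sup>2"
      by (simp add: power2_eq_square algebra_simps)
    ultimately have "p dvd (x * z)\<^sup>2 + 6" using dvd by simp
    then show False using not_dvd_square_plus_6[OF p] by blast
  qed
  then have "p dvd 24 * y\<^sup>2" by (simp add: power2_eq_square)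
  then have "p dvd x\<^sup>2" using dvd by (simp add: dvd_add_left_iff)
  then show ?thesis using y p(1) prime_dvd_power by blast
qed

section \<open>Chebyshev's method\<close>

text \<open>Expand \<open>ln k\<close> over the divisors of \<open>k\<close> and set
  \<open>k = d m\<close>. Used with \<open>f = 1\<close> for factorials and with
  \<open>f = chi\<close> for the twisted sum.\<close>

lemma sum_ln_eq_sum_mangoldt:
  fixes f :: "nat \<Rightarrow> real"
  shows "(\<Sum>k=1..n. f k * ln (real k)) = (\<Sum>d=1..n. mangoldt d * (\<Sum>m=1..n div d. f (d * m)))"
proof -
  have "(\<Sum>k=1..n. f k * ln (real k)) = (\<Sum>k=1..n. \<Sum>d | d dvd k. mangoldt d * f k)"
  proof (rule sum.cong)
    fix k assume "k \<in> {1..n}"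
    then have "ln (real k) = (\<Sum>d | d dvd k. mangoldt d)" using mangoldt_sum[of k, where 'a = real] by simp
    then show "f k * ln (real k) = (\<Sum>d | d dvd k. mangoldt d * f k)"
      by (simp add: sum_distrib_left mult.commute)
  qed simp
  also have "\<dots> = (\<Sum>(k, d)\<in>(SIGMA k:{1..n}. {d. d dvd k}). mangoldt d * f k)"
    by (rule sum.Sigma) auto
  also have "\<dots> = (\<Sum>(d, m)\<in>(SIGMA d:{1..n}. {1..n div d}). mangoldt d * f (d * m))"
  proof (rule sum.reindex_bij_witness[where i = "\<lambda>(d, m). (d * m, d)" and j = "\<lambda>(k, d). (d, k div d)"])
    fix x assume "x \<in> (SIGMA k:{1..n}. {d. d dvd k})"
    then obtain k d where x: "x = (k, d)" "1 \<le> k" "k \<le> n" "d dvd k" by auto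
    have "1 \<le> d" "d \<le> k" using x by (auto simp: dvd_imp_le Suc_le_eq intro!: Nat.gr0I)
    moreover have "1 \<le> k div d" using x \<open>1 \<le> d\<close> \<open>d \<le> k\<close> by (simp add: Suc_le_eq div_greater_zero_iff)
    moreover have "k div d \<le> n div d" using x by (intro div_le_mono)
    ultimately show "(case x of (k, d) \<Rightarrow> (d, k div d)) \<in> (SIGMA d:{1..n}. {1..n div d})"
      using x by auto
    show "(case (case x of (k, d) \<Rightarrow> (d, k div d)) of (d, m) \<Rightarrow> (d * m, d)) = x"
      using x by simp
    show "(case (case x of (k, d) \<Rightarrow> (d, k div d)) of (d, m) \<Rightarrow> mangoldt d * f (d * m)) =
        (case x of (k, d) \<Rightarrow> mangoldt d * f k)"
      using x by simp
  next
    fix y assume "y \<in> (SIGMA d:{1..n}. {1..n div d})"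
    then obtain d m where y: "y = (d, m)" "1 \<le> d" "d \<le> n" "1 \<le> m" "m \<le> n div d" by auto
    have "d * m \<le> d * (n div d)" using y by (intro mult_le_mono2)
    also have "\<dots> \<le> n" by simp
    finally have "d * m \<le> n" .
    then show "(case y of (d, m) \<Rightarrow> (d * m, d)) \<in> (SIGMA k:{1..n}. {d. d dvd k})"
      using y by auto
    show "(case (case y of (d, m) \<Rightarrow> (d * m, d)) of (k, d) \<Rightarrow> (d, k div d)) = y"
      using y by simp
  qed
  also have "\<dots> = (\<Sum>d=1..n. \<Sum>m=1..n div d. mangoldt d * f (d * m))"
    by (rule sum.Sigma[symmetric]) auto
  finally show ?thesis by (simp add: sum_distrib_left)
qed

definition psi :: "nat \<Rightarrow> real" where
  "psi n = (\<Sum>d=1..n. mangoldt d)"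

lemma psi_mono: "m \<le> n \<Longrightarrow> psi m \<le> psi n"
  unfolding psi_def by (intro sum_mono2) (auto simp: mangoldt_nonneg)

text \<open>Legendre's formula. The weights are 0 or 1, and 1 for \<open>m < d <= 2m\<close>, so the
  same identity bounds \<open>psi (2m)\<close> below and \<open>psi (2m) - psi m\<close>
  above.\<close>

lemma ln_central_binomial:
  "ln (real (2 * m choose m)) =
    (\<Sum>d=1..2*m. mangoldt d * real_of_int (int (2 * m div d) - 2 * int (m div d)))"
proof -
  have ln_fact: "ln (fact n :: real) = (\<Sum>d=1..n. mangoldt d * real (n div d))" for n
  proof -
    have "ln (fact n :: real) = (\<Sum>k=1..n. ln (real k))"
      by (induction n) (simp_all add: ln_mult)
    also have "\<dots> = (\<Sum>d=1..n. mangoldt d * (\<Sum>m=1..n div d. 1))"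
      using sum_ln_eq_sum_mangoldt[of "\<lambda>_. 1" n] by simp
    finally show ?thesis by simp
  qed
  have "real (2 * m choose m) = fact (2 * m) / (fact m * fact m)"
    by (subst binomial_fact) (simp_all add: mult_2)
  then have "ln (real (2 * m choose m)) = ln (fact (2 * m)) - 2 * ln (fact m)"
    by (simp add: ln_div ln_mult)
  also have "ln (fact m :: real) = (\<Sum>d=1..2*m. mangoldt d * real (m div d))"
    unfolding ln_fact by (rule sum.mono_neutral_left) auto
  finally show ?thesis
    by (simp add: ln_fact sum_distrib_left sum_subtractf algebra_simps)
qed

lemma div_double_cases:
  fixes m d :: nat
  shows "int (2 * m div d) - 2 * int (m div d) \<in> {0, 1}"
proof (cases "d = 0")
  case False
  define q r where "q = m div d" and "r = m mod d"
  have r: "r < d" using False by (simp add: r_def)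
  have "m = d * q + r" by (simp add: q_def r_def)
  then have "2 * m = 2 * r + d * (2 * q)" by simp
  then have "2 * m div d = 2 * q + 2 * r div d"
    using False by (simp only: div_mult_self2) simp
  moreover have "2 * r div d < 2" using r False by (simp add: div_less_iff_less_mult)
  ultimately show ?thesis by (auto simp: q_def)
qed simp

lemma ln_central_binomial_le_psi: "ln (real (2 * m choose m)) \<le> psi (2 * m)"
  unfolding ln_central_binomial psi_def
proof (rule sum_mono)
  fix d
  have le: "mangoldt d * real_of_int c \<le> mangoldt d" if "c \<in> {0, 1}" for c
    using that mangoldt_nonneg[of d] by auto
  show "mangoldt d * real_of_int (int (2 * m div d) - 2 * int (m div d)) \<le> mangoldt d"
    by (rule le[OF div_double_cases])
qed

lemma psi_diff_le: "psi (2 * m) - psi m \<le> real (2 * m) * ln 2"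
proof -
  have "psi (2 * m) - psi m = (\<Sum>d=m+1..2*m. mangoldt d)"
  proof -
    have "{1..2*m} = {1..m} \<union> {m+1..2*m}" by auto
    then have "psi (2 * m) = psi m + (\<Sum>d=m+1..2*m. mangoldt d)"
      unfolding psi_def by (simp add: sum.union_disjoint)
    then show ?thesis by simp
  qed
  also have "\<dots> \<le> (\<Sum>d=1..2*m. mangoldt d * real_of_int (int (2 * m div d) - 2 * int (m div d)))"
  proof (rule sum_le_included[where i = id])
    show "\<forall>d\<in>{1..2*m}. 0 \<le> mangoldt d * real_of_int (int (2 * m div d) - 2 * int (m div d))"
    proof
      fix d
      have le: "0 \<le> mangoldt d * real_of_int c" if "c \<in> {0, 1}" for c
        using that mangoldt_nonneg[of d] by auto
      show "0 \<le> mangoldt d * real_of_int (int (2 * m div d) - 2 * int (m div d))"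
        by (rule le[OF div_double_cases])
    qed
    show "\<forall>d\<in>{m+1..2*m}. \<exists>e\<in>{1..2*m}. id e = d \<and>
        mangoldt d \<le> mangoldt e * real_of_int (int (2 * m div e) - 2 * int (m div e))"
    proof
      fix d assume d: "d \<in> {m+1..2*m}"
      have "2 * m div d > 0" using d by (simp add: div_greater_zero_iff)
      moreover have "m div d = 0" using d by simp
      ultimately have "int (2 * m div d) - 2 * int (m div d) = 1"
        using div_double_cases[of m d] by auto
      then show "\<exists>e\<in>{1..2*m}. id e = d \<and>
          mangoldt d \<le> mangoldt e * real_of_int (int (2 * m div e) - 2 * int (m div e))"
        using d by (intro bexI[of _ d]) auto
    qed
  qed auto
  also have "\<dots> = ln (real (2 * m choose m))" by (rule ln_central_binomial[symmetric])
  also have "\<dots> \<le> ln (real (2 ^ (2 * m)))"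
  proof -
    have "real (2 * m choose m) \<le> real (2 ^ (2 * m))"
      using binomial_le_pow2[of "2 * m" m] by (rule of_nat_mono)
    then show ?thesis by (intro ln_mono) auto
  qed
  also have "\<dots> = real (2 * m) * ln 2" by (simp add: ln_realpow)
  finally show ?thesis .
qed

text \<open>Repeated halving. The constant 4 leaves room for the odd case: with
  \<open>n = 2m + 1\<close> the extra term is at most \<open>ln n <= 2m ln 2\<close>, for a total of
  \<open>8m ln 2\<close>.\<close>

lemma psi_le: "psi n \<le> 4 * ln 2 * real n"
proof (induction n rule: less_induct)
  case (less n)
  show ?case
  proof (cases "n \<le> 1")
    case True
    then have "psi n = 0" by (cases n) (auto simp: psi_def)
    then show ?thesis by simp
  next
    case False
    define m where "m = n div 2"
    have m: "m < n" "m \<ge> 1" using False by (auto simp: m_def)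
    have IH: "psi m \<le> 4 * ln 2 * real m" using less.IH m by blast
    have *: "psi (2 * m) \<le> 4 * ln 2 * real m + real (2 * m) * ln 2"
      using psi_diff_le[of m] IH by linarith
    show ?thesis
    proof (cases "even n")
      case True
      then have n: "n = 2 * m" by (simp add: m_def)
      have "4 * ln 2 * real m + real (2 * m) * ln 2 \<le> 4 * ln 2 * real n"
        unfolding n by (simp add: mult_ac)
      then show ?thesis using * unfolding n by linarith
    next
      case False
      then have n: "n = Suc (2 * m)" by (simp add: m_def)
      have "psi n = psi (2 * m) + mangoldt n" unfolding psi_def n by simp
      also have "mangoldt n \<le> ln (real n)" using m by (intro mangoldt_le) auto
      also have "ln (real n) \<le> ln (real (2 ^ (2 * m)))"
      proof -
        have "Suc (2 * m) \<le> 2 ^ (2 * m)" by (rule Suc_leI) (rule less_exp)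
        then have "real n \<le> real (2 ^ (2 * m))" unfolding n by (rule of_nat_mono)
        then show ?thesis using m by (intro ln_mono) auto
      qed
      also have "\<dots> = real (2 * m) * ln 2" by (simp add: ln_realpow)
      finally have "psi n \<le> 4 * ln 2 * real m + real (2 * m) * ln 2 + real (2 * m) * ln 2"
        using * by simp
      also have "\<dots> \<le> 4 * ln 2 * real n"
        by (simp add: n distrib_left)
      finally show ?thesis .
    qed
  qed
qed

text \<open>The largest binomial coefficient in row \<open>2m\<close> is at least
  \<open>4^m / (2m + 1)\<close>. Rounding \<open>n\<close> down to the even number \<open>2m\<close>
  costs the 1 in \<open>n - 1\<close>.\<close>

lemma psi_ge: "(real n - 1) * ln 2 - ln (real n + 1) \<le> psi n"
proof -
  define m where "m = n div 2"
  have m: "2 * m \<le> n" "n \<le> 2 * m + 1" by (auto simp: m_def)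
  have "2 ^ (2 * m) = (\<Sum>k\<le>2*m. 2 * m choose k)" by (rule choose_row_sum[symmetric])
  also have "\<dots> \<le> (\<Sum>k\<le>2*m. 2 * m choose m)" by (intro sum_mono binomial_maximum')
  finally have "2 ^ (2 * m) \<le> (2 * m + 1) * (2 * m choose m)" by simp
  then have "real (2 ^ (2 * m)) \<le> real ((2 * m + 1) * (2 * m choose m))" by (rule of_nat_mono)
  then have "ln (real (2 ^ (2 * m))) \<le> ln (real ((2 * m + 1) * (2 * m choose m)))"
    by (intro ln_mono) auto
  also have "\<dots> = ln (real (2 * m + 1)) + ln (real (2 * m choose m))"
    unfolding of_nat_mult by (rule ln_mult_pos) simp_all
  also have "ln (real (2 ^ (2 * m))) = real (2 * m) * ln 2" by (simp add: ln_realpow)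
  finally have "real (2 * m) * ln 2 - ln (real (2 * m + 1)) \<le> psi (2 * m)"
    using ln_central_binomial_le_psi[of m] by linarith
  moreover have "psi (2 * m) \<le> psi n" using m by (intro psi_mono)
  moreover have "ln (real (2 * m + 1)) \<le> ln (real n + 1)" using m by (intro ln_mono) auto
  moreover have "(real n - 1) * ln 2 \<le> real (2 * m) * ln 2" using m by (intro mult_right_mono) auto
  ultimately show ?thesis by linarith
qed

text \<open>A prime \<open>p\<close> has at most \<open>ln n / ln p\<close> powers up to
  \<open>n\<close>, each of weight \<open>ln p\<close>, so it contributes at most
  \<open>ln n\<close> in all. \<open>P\<close> selects the prime powers, \<open>Q\<close> their base
  primes.\<close>

lemma sum_mangoldt_le_card_primes:
  fixes P Q :: "nat \<Rightarrow> bool"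
  assumes PQ: "\<And>p k. prime p \<Longrightarrow> k > 0 \<Longrightarrow> P (p ^ k) \<Longrightarrow> Q p"
  shows "(\<Sum>d\<in>{d\<in>{1..n}. P d}. mangoldt d :: real) \<le> real (card {p. prime p \<and> p \<le> n \<and> Q p}) * ln (real n)"
proof -
  define S where "S = {d\<in>{1..n}. P d \<and> primepow d}"
  define T where "T = {p. prime p \<and> p \<le> n \<and> Q p}"
  have decompose: "\<exists>p k. prime p \<and> k > 0 \<and> d = p ^ k \<and> aprimedivisor d = p" if d: "primepow d" for d :: nat
  proof -
    obtain p k where pk: "prime p" "k > 0" "d = p ^ k"
      using d by (auto simp: primepow_def)
    then have "aprimedivisor d = p" by (simp add: aprimedivisor_prime_power)
    then show ?thesis using pk by (intro exI[of _ p] exI[of _ k]) simp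
  qed
  have fin: "finite S" "finite T" by (auto simp: S_def T_def)
  have "(\<Sum>d\<in>{d\<in>{1..n}. P d}. mangoldt d :: real) = (\<Sum>d\<in>S. mangoldt d)"
    by (rule sum.mono_neutral_right) (auto simp: S_def mangoldt_def)
  also have "\<dots> = (\<Sum>p\<in>T. \<Sum>d\<in>{d\<in>S. aprimedivisor d = p}. mangoldt d)"
  proof (rule sum.group[symmetric, OF fin])
    show "aprimedivisor ` S \<subseteq> T"
    proof
      fix p assume "p \<in> aprimedivisor ` S"
      then obtain d where d: "d \<in> S" "p = aprimedivisor d" by blast
      have "primepow d" "P d" using d(1) by (simp_all add: S_def)
      then obtain k where k: "prime p" "k > 0" "d = p ^ k"
        using decompose[of d] d(2) by metis
      then have "Q p" using PQ \<open>P d\<close> by metis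
      moreover have "p \<le> n"
      proof -
        have "p dvd d" using k by simp
        then have "p \<le> d" using d by (auto simp: S_def intro: dvd_imp_le)
        then show ?thesis using d by (simp add: S_def)
      qed
      ultimately show "p \<in> T" using k by (simp add: T_def)
    qed
  qed
  also have "\<dots> \<le> (\<Sum>p\<in>T. ln (real n))"
  proof (rule sum_mono)
    fix p assume "p \<in> T"
    then have p: "prime p" "p \<le> n" by (auto simp: T_def)
    then have p1: "p > 1" "n > 0" using prime_gt_1_nat[of p] by auto
    then have lnp: "ln (real p) > 0" by simp
    define K where "K = nat \<lfloor>ln (real n) / ln (real p)\<rfloor>"
    have "{d\<in>S. aprimedivisor d = p} \<subseteq> (\<lambda>k. p ^ k) ` {1..K}"
    proof
      fix d assume d: "d \<in> {d\<in>S. aprimedivisor d = p}"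
      then have "primepow d" "aprimedivisor d = p" by (simp_all add: S_def)
      then obtain k where k: "k > 0" "d = p ^ k" using decompose[of d] by metis
      have "real (p ^ k) \<le> real n" using d k by (auto simp: S_def)
      then have "ln (real (p ^ k)) \<le> ln (real n)" using p1 by (intro ln_mono) auto
      then have "real k * ln (real p) \<le> ln (real n)" using p1 by (simp add: ln_realpow)
      then have "real k \<le> ln (real n) / ln (real p)" using lnp by (simp add: field_simps)
      then have "k \<le> K" unfolding K_def by (simp add: le_nat_floor)
      then show "d \<in> (\<lambda>k. p ^ k) ` {1..K}" using k by auto
    qed
    then have "card {d\<in>S. aprimedivisor d = p} \<le> K"
      using surj_card_le[of "{1..K}" "{d\<in>S. aprimedivisor d = p}" "\<lambda>k. p ^ k"] by simp
    moreover have "real K \<le> ln (real n) / ln (real p)"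
      unfolding K_def using lnp p1 by (intro of_nat_floor) auto
    ultimately have *: "real (card {d\<in>S. aprimedivisor d = p}) * ln (real p) \<le> ln (real n)"
      using lnp by (simp add: pos_le_divide_eq) (smt (verit) mult_right_mono of_nat_mono)
    have "(\<Sum>d\<in>{d\<in>S. aprimedivisor d = p}. mangoldt d :: real) = (\<Sum>d\<in>{d\<in>S. aprimedivisor d = p}. ln (real p))"
      by (rule sum.cong) (auto simp: S_def mangoldt_def)
    then show "(\<Sum>d\<in>{d\<in>S. aprimedivisor d = p}. mangoldt d :: real) \<le> ln (real n)"
      using * by simp
  qed
  finally show ?thesis by (simp add: T_def)
qed

section \<open>The density of the inert primes\<close>

definition chi_sum :: "nat \<Rightarrow> int" where
  "chi_sum n = (\<Sum>k=1..n. chi k)"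

text \<open>The character sums to 0 over a period, so its partial sums are periodic; the thresholds
  are the residues prime to 24.\<close>

definition chi_sum_table :: "nat \<Rightarrow> int" where
  "chi_sum_table r = (if r < 1 then 0 else if r < 5 then 1 else if r < 7 then 2 else if r < 11 then 3
     else if r < 13 then 4 else if r < 17 then 3 else if r < 19 then 2 else if r < 23 then 1 else 0)"

lemma chi_sum_eq_table: "chi_sum n = chi_sum_table (n mod 24)"
proof (induction n)
  case 0 then show ?case by (simp add: chi_sum_def chi_sum_table_def)
next
  case (Suc n)
  have *: "\<forall>r\<in>residues_24. chi_sum_table (Suc r mod 24) = chi_sum_table r + chi (Suc r mod 24)"
    by (simp only: ball_simps) (simp add: chi_sum_table_def chi_def)
  have "chi_sum (Suc n) = chi_sum_table (n mod 24) + chi (Suc (n mod 24) mod 24)"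
    using Suc by (simp only: chi_sum_def mod_Suc_eq chi_mod) simp
  also have "\<dots> = chi_sum_table (Suc (n mod 24) mod 24)"
    by (rule bspec[OF * mod_24_in_residues, symmetric])
  finally show ?case by (simp only: mod_Suc_eq)
qed

lemma chi_sum_nonneg: "0 \<le> chi_sum n" and chi_sum_le_4: "chi_sum n \<le> 4"
  unfolding chi_sum_eq_table by (simp_all add: chi_sum_table_def)

lemma chi_sum_pos: "0 < n \<Longrightarrow> n < 23 \<Longrightarrow> 1 \<le> chi_sum n"
  unfolding chi_sum_eq_table by (simp add: chi_sum_table_def)

text \<open>Summation by parts as an induction. With \<open>ln (n + 1)\<close> in the bound, the new
  term carries the same logarithm; enlarging the logarithm afterwards is allowed because the partial
  sums are nonnegative.\<close>

lemma sum_chi_ln_le: "(\<Sum>k=1..n. of_int (chi k) * ln (real k)) \<le> of_int (chi_sum n) * ln (real n + 1)"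
proof (induction n)
  case 0 then show ?case by (simp add: chi_sum_def)
next
  case (Suc n)
  have "(\<Sum>k=1..Suc n. of_int (chi k) * ln (real k)) \<le>
      of_int (chi_sum n) * ln (real n + 1) + of_int (chi (Suc n)) * ln (real n + 1)"
    using Suc by (simp add: add.commute)
  also have "\<dots> = of_int (chi_sum (Suc n)) * ln (real n + 1)"
    by (simp add: chi_sum_def distrib_right)
  also have "\<dots> \<le> of_int (chi_sum (Suc n)) * ln (real (Suc n) + 1)"
    using chi_sum_nonneg[of "Suc n"] by (intro mult_left_mono) auto
  finally show ?case .
qed

definition psi_chi :: "int \<Rightarrow> nat \<Rightarrow> real" where
  "psi_chi s n = (\<Sum>d\<in>{d\<in>{1..n}. chi d = s}. mangoldt d)"

lemma sum_mangoldt_chi_sum: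
  "(\<Sum>k=1..n. of_int (chi k) * ln (real k)) =
    (\<Sum>d\<in>{d\<in>{1..n}. chi d = 1}. mangoldt d * of_int (chi_sum (n div d))) -
    (\<Sum>d\<in>{d\<in>{1..n}. chi d = -1}. mangoldt d * of_int (chi_sum (n div d)))"
proof -
  have "(\<Sum>k=1..n. of_int (chi k) * ln (real k)) =
      (\<Sum>d=1..n. mangoldt d * (\<Sum>m=1..n div d. of_int (chi (d * m))))"
    by (rule sum_ln_eq_sum_mangoldt)
  also have "\<dots> = (\<Sum>d=1..n. of_int (chi d) * (mangoldt d * of_int (chi_sum (n div d))))"
    by (simp add: chi_mult chi_sum_def sum_distrib_left mult_ac)
  also have "\<dots> = (\<Sum>d=1..n. (if chi d = 1 then mangoldt d * of_int (chi_sum (n div d)) else 0) -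
      (if chi d = -1 then mangoldt d * of_int (chi_sum (n div d)) else 0))"
  proof (rule sum.cong)
    fix d
    show "of_int (chi d) * (mangoldt d * of_int (chi_sum (n div d))) =
        (if chi d = 1 then mangoldt d * of_int (chi_sum (n div d)) else 0) -
        (if chi d = -1 then mangoldt d * of_int (chi_sum (n div d)) else (0::real))"
      using chi_values[of d] by (elim disjE) simp_all
  qed simp
  finally show ?thesis
    by (simp only: sum_subtractf sum.inter_filter[OF finite_atLeastAtMost])
qed

lemma psi_split:
  "psi n = psi_chi 1 n + psi_chi (-1) n + psi_chi 0 n"
proof -
  have "{1..n} = {d\<in>{1..n}. chi d = 1} \<union> {d\<in>{1..n}. chi d = -1} \<union> {d\<in>{1..n}. chi d = 0}"
    using chi_values by auto
  then have "psi n = sum mangoldt ({d\<in>{1..n}. chi d = 1} \<union> {d\<in>{1..n}. chi d = -1} \<union> {d\<in>{1..n}. chi d = 0})"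
    unfolding psi_def by (rule arg_cong)
  also have "\<dots> = psi_chi 1 n + psi_chi (-1) n + psi_chi 0 n"
    unfolding psi_chi_def by (subst sum.union_disjoint; (subst sum.union_disjoint)?) auto
  finally show ?thesis .
qed

lemma psi_chi_0_le: "psi_chi 0 n \<le> 2 * ln (real n + 1)"
proof -
  have "psi_chi 0 n \<le> real (card {p. prime p \<and> p \<le> n \<and> (p = 2 \<or> p = 3)}) * ln (real n)"
    unfolding psi_chi_def
  proof (rule sum_mangoldt_le_card_primes)
    fix p k :: nat assume p: "prime p" "chi (p ^ k) = 0"
    then have "chi p = 0" by (simp add: chi_power)
    then have "2 dvd p \<or> 3 dvd p" by (simp add: chi_eq_0_iff)
    moreover have "prime (2::nat)" "prime (3::nat)" by simp_all
    ultimately show "p = 2 \<or> p = 3"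
      using p(1) primes_dvd_imp_eq[of 2 p] primes_dvd_imp_eq[of 3 p] by blast
  qed
  also have "\<dots> \<le> 2 * ln (real n + 1)"
  proof (cases "n = 0")
    case False
    have "card {p. prime p \<and> p \<le> n \<and> (p = 2 \<or> p = 3)} \<le> card {2, 3 :: nat}"
      by (intro card_mono) auto
    then have "card {p. prime p \<and> p \<le> n \<and> (p = 2 \<or> p = 3)} \<le> 2" by simp
    moreover have "ln (real n) \<le> ln (real n + 1)" "0 \<le> ln (real n)" using False by auto
    ultimately show ?thesis by (intro mult_mono) auto
  qed simp
  finally show ?thesis .
qed

lemma psi_chi_nonneg: "0 \<le> psi_chi s n"
  unfolding psi_chi_def by (intro sum_nonneg) (auto simp: mangoldt_nonneg)

text \<open>
  The partial sums of the character are nonnegative, at most 4, and positive on \<open>{1..<23}\<close>, so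
  inert prime powers cannot be much rarer than split ones in \<open>{n div 23<..n}\<close>.
\<close>

lemma psi_split_le_psi_inert:
  "psi_chi 1 n - psi_chi 1 (n div 23) \<le> 4 * psi_chi (-1) n + 4 * ln (real n + 1)"
proof -
  define g where "g d = mangoldt d * real_of_int (chi_sum (n div d))" for d
  define S where "S s = {d\<in>{1..n}. chi d = s}" for s
  have g_nonneg: "0 \<le> g d" for d
    unfolding g_def using mangoldt_nonneg[of d] chi_sum_nonneg by simp
  have "psi_chi 1 n - psi_chi 1 (n div 23) = (\<Sum>d\<in>{d\<in>{n div 23<..n}. chi d = 1}. mangoldt d)"
  proof -
    have "{d\<in>{1..n}. chi d = 1} = {d\<in>{1..n div 23}. chi d = 1} \<union> {d\<in>{n div 23<..n}. chi d = 1}"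
      using div_le_dividend[of n 23] by (auto simp del: div_le_dividend)
    then have "psi_chi 1 n = psi_chi 1 (n div 23) + (\<Sum>d\<in>{d\<in>{n div 23<..n}. chi d = 1}. mangoldt d)"
      unfolding psi_chi_def by (simp only:) (rule sum.union_disjoint, auto)
    then show ?thesis by simp
  qed
  also have "\<dots> \<le> (\<Sum>d\<in>{d\<in>{n div 23<..n}. chi d = 1}. g d)"
  proof (rule sum_mono)
    fix d assume d: "d \<in> {d\<in>{n div 23<..n}. chi d = 1}"
    then have "0 < n div d" by (auto simp: div_greater_zero_iff)
    moreover have "n div d < 23"
      using d by (auto simp: div_less_iff_less_mult mult.commute)
    ultimately have "1 \<le> chi_sum (n div d)" by (rule chi_sum_pos)
    then have "mangoldt d * 1 \<le> mangoldt d * real_of_int (chi_sum (n div d))"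
      using mangoldt_nonneg[of d] by (intro mult_left_mono) auto
    then show "mangoldt d \<le> g d" by (simp add: g_def)
  qed
  also have "\<dots> \<le> sum g (S 1)"
    by (intro sum_mono2) (auto simp: S_def g_nonneg)
  \<comment> \<open>Here the split prime powers are exchanged for the inert ones, at the cost of the
    twisted sum of logarithms.\<close>
  also have "\<dots> = sum g (S (-1)) + (\<Sum>k=1..n. of_int (chi k) * ln (real k))"
    unfolding sum_mangoldt_chi_sum g_def S_def by simp
  also have "(\<Sum>k=1..n. of_int (chi k) * ln (real k)) \<le> 4 * ln (real n + 1)"
  proof -
    have "of_int (chi_sum n) * ln (real n + 1) \<le> 4 * ln (real n + 1)"
      using chi_sum_le_4[of n] by (intro mult_right_mono) auto
    then show ?thesis using sum_chi_ln_le[of n] by linarith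
  qed
  also have "sum g (S (-1)) \<le> (\<Sum>d\<in>S (-1). 4 * mangoldt d)"
  proof (rule sum_mono)
    fix d
    have "mangoldt d * real_of_int (chi_sum (n div d)) \<le> mangoldt d * 4"
      using chi_sum_le_4[of "n div d"] mangoldt_nonneg[of d] by (intro mult_left_mono) auto
    then show "g d \<le> 4 * mangoldt d" by (simp add: g_def mult.commute)
  qed
  also have "\<dots> = 4 * psi_chi (-1) n"
    unfolding psi_chi_def S_def by (simp add: sum_distrib_left)
  finally show ?thesis by simp
qed

text \<open>The inert part enters \<open>1 + 4\<close> times, through \<open>psi_split\<close> and
  \<open>psi_split_le_psi_inert\<close>, and the logarithms \<open>1 + 2 + 4\<close> times; 2/3 and
  3 bound \<open>ln 2\<close> and \<open>4 ln 2\<close>. The main term is positive because 2/3 >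
  3/23.\<close>

lemma psi_inert_ge:
  "(real n - 1) * (2 / 3) - 3 * (real n / 23) - 7 * ln (real n + 1) \<le> 5 * psi_chi (-1) n"
proof -
  have "psi_chi 1 (n div 23) \<le> psi (n div 23)"
    using psi_split[of "n div 23"] psi_chi_nonneg[of "-1" "n div 23"] psi_chi_nonneg[of 0 "n div 23"]
    by linarith
  also have "\<dots> \<le> 4 * ln 2 * real (n div 23)" by (rule psi_le)
  also have "\<dots> \<le> 3 * (real n / 23)"
  proof -
    have "4 * ln 2 \<le> (3::real)" using ln2_le_25_over_36 by simp
    moreover have "real (n div 23) \<le> real n / 23"
    proof -
      have "real (23 * (n div 23)) \<le> real n" by (intro of_nat_mono) simp
      then show ?thesis by simp
    qed
    ultimately show ?thesis by (intro mult_mono) auto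
  qed
  finally have 1: "psi_chi 1 (n div 23) \<le> 3 * (real n / 23)" .
  have 2: "(real n - 1) * (2 / 3) - ln (real n + 1) \<le> psi n"
  proof (cases "n = 0")
    case False
    then have "(real n - 1) * (2 / 3) \<le> (real n - 1) * ln 2"
      using ln2_ge_two_thirds by (intro mult_left_mono) auto
    then show ?thesis using psi_ge[of n] by linarith
  qed (simp add: psi_def)
  show ?thesis
    using 1 2 psi_split[of n] psi_chi_0_le[of n] psi_split_le_psi_inert[of n] by linarith
qed

definition prime_count :: "nat \<Rightarrow> nat" where
  "prime_count n = card {p::nat. prime p \<and> p \<le> n}"

definition inert_count :: "nat \<Rightarrow> nat" where
  "inert_count n = card {p::nat. prime p \<and> p \<le> n \<and> chi p = -1}"

lemma psi_inert_le: "psi_chi (-1) n \<le> real (inert_count n) * ln (real n)"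
  unfolding psi_chi_def inert_count_def
proof (rule sum_mangoldt_le_card_primes)
  fix p k :: nat assume "chi (p ^ k) = -1"
  then have "chi p ^ k = -1" by (simp add: chi_power)
  moreover have "chi p ^ k = 0 \<or> chi p ^ k = 1" if "chi p \<noteq> -1"
    using chi_values[of p] that by (cases "k = 0") auto
  ultimately show "chi p = -1" by fastforce
qed

text \<open>Primes up to \<open>sqrt n\<close> are counted trivially; each larger one adds at least
  \<open>ln n / 2\<close> to \<open>psi n <= 3 n\<close>, whence the 6.\<close>

lemma prime_count_le:
  assumes "n > 1"
  shows "real (prime_count n) * ln (real n) \<le> sqrt (real n) * ln (real n) + 6 * real n"
proof -
  define A where "A = {p. prime p \<and> p \<le> n \<and> real p \<le> sqrt (real n)}"
  define B where "B = {p. prime p \<and> p \<le> n \<and> sqrt (real n) < real p}"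
  have "{p::nat. prime p \<and> p \<le> n} = A \<union> B" by (auto simp: A_def B_def)
  then have "prime_count n = card A + card B"
    unfolding prime_count_def by (simp only:) (rule card_Un_disjoint, auto simp: A_def B_def)
  moreover have "real (card A) \<le> sqrt (real n)"
  proof -
    have "A \<subseteq> {1..nat \<lfloor>sqrt (real n)\<rfloor>}"
      by (auto simp: A_def le_nat_floor Suc_le_eq prime_gt_0_nat)
    then have "card A \<le> card {1..nat \<lfloor>sqrt (real n)\<rfloor>}" by (intro card_mono) auto
    then have "card A \<le> nat \<lfloor>sqrt (real n)\<rfloor>" by simp
    then have "real (card A) \<le> real (nat \<lfloor>sqrt (real n)\<rfloor>)" by (rule of_nat_mono)
    also have "\<dots> \<le> sqrt (real n)" by (intro of_nat_floor) auto
    finally show ?thesis .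
  qed
  moreover have "real (card B) * ln (real n) \<le> 6 * real n"
  proof -
    have "real (card B) * (ln (real n) / 2) = (\<Sum>p\<in>B. ln (real n) / 2)" by simp
    also have "\<dots> \<le> (\<Sum>p\<in>B. mangoldt p)"
    proof (rule sum_mono)
      fix p assume p: "p \<in> B"
      have "ln (real n) / 2 = ln (sqrt (real n))" using assms by (simp add: ln_sqrt)
      also have "\<dots> \<le> ln (real p)" using p assms by (intro ln_mono) (auto simp: B_def)
      also have "\<dots> = mangoldt p" using p by (simp add: B_def)
      finally show "ln (real n) / 2 \<le> mangoldt p" .
    qed
    also have "\<dots> \<le> psi n"
      unfolding psi_def
      by (intro sum_mono2) (auto simp: B_def mangoldt_nonneg Suc_le_eq prime_gt_0_nat)
    also have "\<dots> \<le> 4 * ln 2 * real n" by (rule psi_le)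
    also have "\<dots> \<le> 3 * real n"
      using ln2_le_25_over_36 by (intro mult_right_mono) auto
    finally show ?thesis by simp
  qed
  moreover have "0 \<le> ln (real n)" using assms by simp
  ultimately show ?thesis
    by (simp add: distrib_right) (smt (verit) mult_right_mono)
qed

text \<open>As 2/3 - 3/23 > 1/2, the inert part of \<open>psi\<close> is eventually at least
  \<open>n / 10\<close>, while all primes up to \<open>n\<close> together weigh at most
  \<open>(6 + 1) n\<close>; hence 1/70.\<close>

lemma eventually_inert_ratio:
  "eventually (\<lambda>n. 1 / 70 \<le> real (inert_count n) / real (prime_count n)) sequentially"
proof -
  have "eventually (\<lambda>n::nat. real n / 2 \<le>
      (real n - 1) * (2 / 3) - 3 * (real n / 23) - 7 * ln (real n + 1)) sequentially"
    by real_asymp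
  moreover have "eventually (\<lambda>n::nat. sqrt (real n) * ln (real n) \<le> real n) sequentially"
    by real_asymp
  ultimately show ?thesis
    using eventually_gt_at_top[of 2]
  proof eventually_elim
    case (elim n)
    have ln: "ln (real n) > 0" using elim by simp
    have "real n / 10 \<le> psi_chi (-1) n" using psi_inert_ge[of n] elim by linarith
    also have "\<dots> \<le> real (inert_count n) * ln (real n)" by (rule psi_inert_le)
    finally have 1: "real n / 10 \<le> real (inert_count n) * ln (real n)" .
    have "real (prime_count n) * ln (real n) \<le> 7 * real n"
      using prime_count_le[of n] elim by linarith
    also have "\<dots> \<le> (70 * real (inert_count n)) * ln (real n)" using 1 by simp
    finally have "real (prime_count n) \<le> 70 * real (inert_count n)"
      using ln by (simp add: mult_le_cancel_right)
    moreover have "0 < prime_count n"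
    proof -
      have "2 \<in> {p::nat. prime p \<and> p \<le> n}" using elim by simp
      moreover have "finite {p::nat. prime p \<and> p \<le> n}" by simp
      ultimately show ?thesis unfolding prime_count_def card_gt_0_iff by blast
    qed
    ultimately show ?case by (simp add: field_simps)
  qed
qed

theorem prime_lower_density_pos:
  assumes "\<And>p. prime p \<Longrightarrow> chi p = -1 \<Longrightarrow> p \<in> A"
  shows "prime_lower_density A > 0"
proof -
  have "eventually (\<lambda>x. ereal (1 / 70) \<le> ereal (real (card {p\<in>A. prime p \<and> p \<le> x})
      / real (card {p::nat. prime p \<and> p \<le> x}))) sequentially"
    using eventually_inert_ratio
  proof eventually_elim
    case (elim n)
    have "{p::nat. prime p \<and> p \<le> n \<and> chi p = -1} \<subseteq> {p\<in>A. prime p \<and> p \<le> n}"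
      using assms by blast
    then have "inert_count n \<le> card {p\<in>A. prime p \<and> p \<le> n}"
      unfolding inert_count_def by (intro card_mono) auto
    then have "real (inert_count n) / real (prime_count n) \<le>
        real (card {p\<in>A. prime p \<and> p \<le> n}) / real (prime_count n)"
      by (intro divide_right_mono) auto
    with elim have "1 / 70 \<le> real (card {p\<in>A. prime p \<and> p \<le> n}) / real (prime_count n)"
      by (rule order_trans)
    then show ?case by (simp only: ereal_less_eq prime_count_def)
  qed
  then have "ereal (1 / 70) \<le> prime_lower_density A"
    unfolding prime_lower_density_def by (rule Liminf_bounded)
  moreover have "0 < ereal (1 / 70)" by simp
  ultimately show ?thesis by (rule less_le_trans[rotated])
qed

section \<open>The congruence at inert primes\<close>

lemma of_nat_bit_eq_iff: "(of_nat a :: bit) = of_nat b \<longleftrightarrow> [int a = int b] (mod 2)"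
proof -
  have "(of_nat n :: bit) = of_bool (odd n)" for n by (induction n) auto
  moreover have "[int a = int b] (mod 2) \<longleftrightarrow> (odd a \<longleftrightarrow> odd b)"
    unfolding Cong.cong_def by presburger
  ultimately show ?thesis by simp
qed

lemma fps_compose_X_power_nth:
  fixes F :: "'a::comm_ring_1 fps"
  assumes "p > 0"
  shows "(F oo fps_X ^ p) $ n = (if p dvd n then F $ (n div p) else 0)"
proof -
  have "(F oo fps_X ^ p) $ n = (\<Sum>i=0..n. if n = p * i then F $ i else 0)"
    by (auto simp: fps_compose_nth simp flip: power_mult intro!: sum.cong)
  also have "\<dots> = (\<Sum>i\<in>{i\<in>{0..n}. n = p * i}. F $ i)"
    by (rule sum.inter_filter[symmetric]) simp
  also have "{i\<in>{0..n}. n = p * i} = (if p dvd n then {n div p} else {})"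
    using assms by auto
  finally show ?thesis by simp
qed

text \<open>\<open>p^2\<close> is 1 modulo 24, so \<open>(p^2 - 1) / 24\<close> is an integer below
  \<open>p^2\<close> whose product with 24 is -1 modulo \<open>p^2\<close>; uniqueness identifies it
  with \<open>alpha p\<close>.\<close>

lemma alpha_eq:
  assumes p: "prime p" "p > 3"
  shows "24 * alpha p + 1 = p\<^sup>2"
proof -
  define a where "a = p\<^sup>2 div 24"
  have "\<not> 2 dvd p" "\<not> 3 dvd p"
    using p primes_dvd_imp_eq[of 2 p] primes_dvd_imp_eq[of 3 p] by auto
  then have "p\<^sup>2 mod 24 = 1" by (intro square_mod_24_eq_1) (simp add: chi_eq_0_iff)
  then have a: "24 * a + 1 = p\<^sup>2" unfolding a_def by (metis mult_div_mod_eq)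
  have "p\<^sup>2 \<ge> 4\<^sup>2" using p by (intro power_mono) auto
  then have "0 < a" "a < p\<^sup>2" using a by auto
  moreover have "[int a = - modular_inverse (int (p\<^sup>2)) 24] (mod int (p\<^sup>2))"
  proof -
    define m i where "m = int (p\<^sup>2)" and "i = modular_inverse m 24"
    have m: "m = 24 * int a + 1" unfolding m_def a[symmetric] by simp
    have "coprime 24 m"
    proof (rule coprimeI)
      fix c :: int assume "c dvd 24" "c dvd m"
      then have "c dvd m - 24 * int a" by (intro dvd_diff dvd_mult2)
      then show "is_unit c" by (simp add: m)
    qed
    then have "[24 * i = 1] (mod m)" unfolding i_def by (rule cong_modular_inverse1)
    then have 1: "[int a * (24 * i) = int a] (mod m)"
      using cong_mult[OF cong_refl[of "int a" m], of "24 * i" 1] by (simp only: mult_1_right)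
    have 2: "int a * (24 * i) = - i + m * i" by (simp add: m algebra_simps)
    have 3: "[- i + m * i = - i] (mod m)" unfolding Cong.cong_def by (rule mod_mult_self2)
    have "[- i = int a] (mod m)" by (rule cong_trans[OF cong_sym[OF 3] 1[unfolded 2]])
    then show ?thesis unfolding i_def m_def by (rule cong_sym)
  qed
  ultimately have "is_alpha p a" by (simp add: is_alpha_def)
  then have "alpha p = a"
    unfolding alpha_def using alpha_unique[OF p] by (intro the1_equality)
  then show ?thesis using a by simp
qed

lemma square_series_nth_mult_square:
  assumes "prime p" "p \<noteq> 3"
  shows "square_series $ (p\<^sup>2 * j) = square_series $ j"
proof -
  have "(\<exists>m::nat. \<not> 3 dvd m \<and> p\<^sup>2 * j = m\<^sup>2) \<longleftrightarrow> (\<exists>m::nat. \<not> 3 dvd m \<and> j = m\<^sup>2)"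
  proof
    assume "\<exists>m::nat. \<not> 3 dvd m \<and> p\<^sup>2 * j = m\<^sup>2"
    then obtain m :: nat where m: "\<not> 3 dvd m" "p\<^sup>2 * j = m\<^sup>2" by blast
    have "p\<^sup>2 dvd m\<^sup>2" unfolding m(2)[symmetric] by simp
    then have "p dvd m" by simp
    then obtain k where k: "m = p * k" by blast
    then have "j = k\<^sup>2" using m(2) assms(1) by (simp add: power_mult_distrib prime_gt_0_nat)
    moreover have "\<not> 3 dvd k" using m(1) k by auto
    ultimately show "\<exists>m::nat. \<not> 3 dvd m \<and> j = m\<^sup>2" by blast
  next
    assume "\<exists>m::nat. \<not> 3 dvd m \<and> j = m\<^sup>2"
    then obtain k :: nat where k: "\<not> 3 dvd k" "j = k\<^sup>2" by blast
    have "\<not> 3 dvd p" using assms primes_dvd_imp_eq[of 3 p] by auto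
    then have "\<not> 3 dvd p * k" using k prime_dvd_mult_iff[of 3 p k] by simp
    then show "\<exists>m::nat. \<not> 3 dvd m \<and> p\<^sup>2 * j = m\<^sup>2" 
      using k by (intro exI[of _ "p * k"]) (simp add: power_mult_distrib)
  qed
  then show ?thesis using assms(1) by (simp add: square_series_nth prime_gt_0_nat)
qed

text \<open>The choice of \<open>a\<close> makes \<open>24 (p^2 i + a) + 1 = p^2 (24 i + 1)\<close>,
  and a factor \<open>p^2\<close> does not change whether a number is a square.\<close>

lemma euler_prod_1_nth_mult_square:
  assumes "prime p" "24 * a + 1 = p\<^sup>2"
  shows "euler_prod 1 $ (p\<^sup>2 * i + a) = euler_prod 1 $ i"
proof -
  have eq: "24 * (p\<^sup>2 * i + a) + 1 = p\<^sup>2 * (24 * i + 1)"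
    using assms(2) by (simp add: algebra_simps)
  have "(\<exists>x::nat. p\<^sup>2 * (24 * i + 1) = x\<^sup>2) \<longleftrightarrow> (\<exists>x::nat. 24 * i + 1 = x\<^sup>2)"
  proof
    assume "\<exists>x::nat. p\<^sup>2 * (24 * i + 1) = x\<^sup>2"
    then obtain x :: nat where x: "p\<^sup>2 * (24 * i + 1) = x\<^sup>2" ..
    have "p\<^sup>2 dvd x\<^sup>2" unfolding x[symmetric] by simp
    then have "p dvd x" by simp
    then obtain y where "x = p * y" by blast
    then have "p\<^sup>2 * (24 * i + 1) = p\<^sup>2 * y\<^sup>2" using x by (simp only: power_mult_distrib)
    moreover have "0 < p\<^sup>2" using assms(1) by (simp add: prime_gt_0_nat)
    ultimately have "24 * i + 1 = y\<^sup>2" by (simp only: nat_mult_eq_cancel1)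
    then show "\<exists>x::nat. 24 * i + 1 = x\<^sup>2" ..
  next
    assume "\<exists>x::nat. 24 * i + 1 = x\<^sup>2"
    then obtain y :: nat where "24 * i + 1 = y\<^sup>2" ..
    then have "p\<^sup>2 * (24 * i + 1) = (p * y)\<^sup>2" by (simp only: power_mult_distrib)
    then show "\<exists>x::nat. p\<^sup>2 * (24 * i + 1) = x\<^sup>2" ..
  qed
  then show ?thesis unfolding euler_prod_1_nth eq by simp
qed

text \<open>With \<open>24 i + 1 = x^2\<close> and \<open>j = m^2\<close>, the relation between
  \<open>i\<close> and \<open>j\<close> reads \<open>x^2 + 24 m^2 = 24 p n + p^2\<close>. Now
  \<open>dvd_norm_form\<close> puts \<open>p\<close> into both \<open>x\<close> and
  \<open>m\<close>, and comparing the factors \<open>p^2\<close> shows that \<open>p\<close> divides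
  \<open>n\<close>.\<close>

lemma inert_support:
  assumes p: "prime p" "chi p = -1" and a: "24 * a + 1 = p\<^sup>2"
    and ij: "i + j = p * n + a"
    and i: "euler_prod 1 $ i \<noteq> 0" and j: "square_series $ j \<noteq> 0"
  obtains i' j' where "i = p\<^sup>2 * i' + a" "j = p\<^sup>2 * j'" "n = p * (i' + j')"
proof -
  have p0: "p > 0" using p(1) by (rule prime_gt_0_nat)
  obtain x :: nat where x: "24 * i + 1 = x\<^sup>2"
    using i unfolding euler_prod_1_nth of_bool_eq_0_iff by blast
  obtain m :: nat where m: "j = m\<^sup>2"
    using j by (cases "j = 0") (auto simp: square_series_nth)
  have "x\<^sup>2 + 24 * m\<^sup>2 = 24 * (i + j) + 1" using x m by simp
  also have "\<dots> = 24 * p * n + p\<^sup>2" unfolding ij a[symmetric] by (simp add: algebra_simps)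
  finally have "p dvd x\<^sup>2 + 24 * m\<^sup>2" by (simp add: power2_eq_square)
  then have "p dvd x \<and> p dvd m" by (rule dvd_norm_form[OF p])
  then have "p dvd x" "p dvd m" by simp_all
  then obtain y k where y: "x = p * y" and k: "m = p * k" by blast
  \<comment> \<open>\<open>x^2 = 24 i + 1\<close> is prime to 6, hence so is
    \<open>y = x / p\<close>; then \<open>y^2\<close> is 1 modulo 24, which makes \<open>i'\<close>
    an integer.\<close>
  have "chi x \<noteq> 0"
  proof
    assume "chi x = 0"
    then have "2 dvd x\<^sup>2 \<or> 3 dvd x\<^sup>2" by (auto simp: chi_eq_0_iff power2_eq_square)
    then show False unfolding x[symmetric] by presburger
  qed
  then have "chi y \<noteq> 0" by (simp add: y chi_mult)
  then have "y\<^sup>2 mod 24 = 1" by (rule square_mod_24_eq_1)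
  then obtain i' where i': "y\<^sup>2 = 24 * i' + 1" by (metis mult_div_mod_eq)
  have "24 * i + 1 = p\<^sup>2 * (24 * i' + 1)" using x y i' by (simp add: power_mult_distrib)
  also have "\<dots> = 24 * (p\<^sup>2 * i' + a) + 1" using a by (simp add: algebra_simps)
  finally have I: "i = p\<^sup>2 * i' + a" by simp
  have J: "j = p\<^sup>2 * k\<^sup>2" by (simp add: m k power_mult_distrib)
  have "p * (p * (i' + k\<^sup>2)) = p * n"
    using ij unfolding I J by (simp add: power2_eq_square algebra_simps)
  then have "n = p * (i' + k\<^sup>2)" using p0 by simp
  then show thesis using I J by (rule that[rotated 2])
qed

text \<open>By \<open>inert_support\<close> the Cauchy product at \<open>p n + alpha p\<close> is
  empty unless \<open>p\<close> divides \<open>n\<close>. Otherwise it runs over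
  \<open>p^2 i + alpha p\<close> and \<open>p^2 (l - i)\<close> with \<open>l = n / p\<close>, where
  both coefficients equal those at \<open>i\<close> and \<open>l - i\<close>.\<close>

lemma inert_coefficients:
  assumes p: "prime p" "chi p = -1" "p > 3"
  defines "F \<equiv> euler_prod 1 * square_series"
  shows "F $ (p * n + alpha p) = (if p dvd n then F $ (n div p) else 0)"
proof -
  define a where "a = alpha p"
  have a: "24 * a + 1 = p\<^sup>2" unfolding a_def by (rule alpha_eq[OF p(1,3)])
  have p0: "p > 0" using p by simp
  define f where "f i = euler_prod 1 $ i * square_series $ (p * n + a - i)" for i
  have F: "F $ (p * n + a) = (\<Sum>i\<in>{0..p * n + a}. f i)"
    by (simp add: F_def f_def fps_mult_nth)
  have supp: "\<exists>i' j'. i = p\<^sup>2 * i' + a \<and> n = p * (i' + j')" if i: "i \<in> {0..p * n + a}" "f i \<noteq> 0" for i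
  proof -
    have "euler_prod 1 $ i \<noteq> 0" "square_series $ (p * n + a - i) \<noteq> 0"
      using i(2) unfolding f_def by auto
    moreover have "i + (p * n + a - i) = p * n + a" using i(1) by simp
    ultimately obtain i' j' where "i = p\<^sup>2 * i' + a" "n = p * (i' + j')"
      using inert_support[OF p(1,2) a] by metis
    then show ?thesis by blast
  qed
  show ?thesis
  proof (cases "p dvd n")
    case False
    have "f i = 0" if i: "i \<in> {0..p * n + a}" for i
    proof (rule ccontr)
      assume "f i \<noteq> 0"
      then obtain i' j' where "n = p * (i' + j')" using supp[OF i] by blast
      then show False using False by simp
    qed
    then show ?thesis using False F by (simp add: a_def)
  next
    case True
    then obtain l where l: "n = p * l" by blast
    have le: "p\<^sup>2 * i + a \<le> p * n + a" if "i \<le> l" for i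
      using that unfolding l by (simp add: power2_eq_square)
    have "(\<Sum>i\<in>{0..p * n + a}. f i) = (\<Sum>i\<in>(\<lambda>i. p\<^sup>2 * i + a) ` {0..l}. f i)"
    proof (rule sum.mono_neutral_right)
      show "(\<lambda>i. p\<^sup>2 * i + a) ` {0..l} \<subseteq> {0..p * n + a}" using le by auto
      show "\<forall>i\<in>{0..p * n + a} - (\<lambda>i. p\<^sup>2 * i + a) ` {0..l}. f i = 0"
      proof (rule ballI, rule ccontr)
        fix i assume i: "i \<in> {0..p * n + a} - (\<lambda>i. p\<^sup>2 * i + a) ` {0..l}" "f i \<noteq> 0"
        then obtain i' j' where "i = p\<^sup>2 * i' + a" "n = p * (i' + j')" using supp[of i] by blast
        moreover from this have "i' \<le> l" using l p0 by simp
        ultimately show False using i(1) by auto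
      qed
    qed simp
    also have "\<dots> = (\<Sum>i\<in>{0..l}. f (p\<^sup>2 * i + a))"
      by (subst sum.reindex) (use p0 in \<open>auto simp: inj_on_def\<close>)
    also have "\<dots> = (\<Sum>i\<in>{0..l}. euler_prod 1 $ i * square_series $ (l - i))"
    proof (rule sum.cong)
      fix i assume i: "i \<in> {0..l}"
      have "p * n + a - (p\<^sup>2 * i + a) = p\<^sup>2 * (l - i)"
        by (simp add: l power2_eq_square right_diff_distrib')
      then show "f (p\<^sup>2 * i + a) = euler_prod 1 $ i * square_series $ (l - i)"
        using p by (simp only: f_def euler_prod_1_nth_mult_square[OF p(1) a])
          (simp add: square_series_nth_mult_square)
    qed simp
    also have "\<dots> = F $ l" by (simp add: F_def fps_mult_nth)
    finally show ?thesis using F l p0 by (simp add: a_def)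
  qed
qed

lemma regular_3_congruence:
  assumes p: "prime p" "chi p = -1" "p > 3"
  shows "[Abs_fps (\<lambda>n. int (b\<^bsub>3\<^esub> (2 * (p * n + alpha p))))
            \<equiv> Abs_fps (\<lambda>n. int (b\<^bsub>3\<^esub> (2 * n))) oo fps_X ^ p] (fps_mod 2)"
proof -
  define F where "F = euler_prod 1 * square_series"
  have F: "of_nat (b\<^bsub>3\<^esub> (2 * n)) = F $ n" for n
    unfolding F_def even_part_regular_3[symmetric] by simp
  have "[int (b\<^bsub>3\<^esub> (2 * (p * n + alpha p))) = (if p dvd n then int (b\<^bsub>3\<^esub> (2 * (n div p))) else 0)] (mod 2)" for n
  proof -
    have "(of_nat (b\<^bsub>3\<^esub> (2 * (p * n + alpha p))) :: bit) =
        of_nat (if p dvd n then b\<^bsub>3\<^esub> (2 * (n div p)) else 0)"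
      using inert_coefficients[OF p, of n, folded F_def]
      by (cases "p dvd n") (simp_all only: F if_True if_False of_nat_0)
    then have "[int (b\<^bsub>3\<^esub> (2 * (p * n + alpha p))) = int (if p dvd n then b\<^bsub>3\<^esub> (2 * (n div p)) else 0)] (mod 2)"
      by (simp only: of_nat_bit_eq_iff)
    then show ?thesis by (cases "p dvd n") (simp_all only: if_True if_False of_nat_0)
  qed
  moreover have "p > 0" using p(3) by simp
  ultimately show ?thesis
    by (simp only: fps_cong_def fps_nth_Abs_fps fps_compose_X_power_nth simp_thms)
qed

theorem theorem1p1:
  shows "positive_proportion_of_primes (\<lambda>p. p > 3 \<and>
           [Abs_fps (\<lambda>n. int (b\<^bsub>3\<^esub> (2 * (p * n + alpha p))))
              \<equiv> Abs_fps (\<lambda>n. int (b\<^bsub>3\<^esub> (2 * n))) oo fps_X ^ p] (fps_mod 2))"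
  unfolding positive_proportion_of_primes_def
proof (rule prime_lower_density_pos)
  fix p :: nat assume p: "prime p" "chi p = -1"
  have "p > 3" using p(2) by (cases "p \<ge> 4") (auto simp: chi_def split: if_splits)
  then show "p \<in> {p. prime p \<and> p > 3 \<and>
      [Abs_fps (\<lambda>n. int (b\<^bsub>3\<^esub> (2 * (p * n + alpha p))))
        \<equiv> Abs_fps (\<lambda>n. int (b\<^bsub>3\<^esub> (2 * n))) oo fps_X ^ p] (fps_mod 2)}"
    using p regular_3_congruence by blast
qed

end
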